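(* Let $\sigma$ be a catalyst and let $\Psi_1$, $\Psi_2$ be a pair of unital maps such that $S^G(\Psi_1)+S^G(\Psi_2)>S^\diamond(\sigma)$. Then $\Psi_1\otimes\Psi_2$ cannot be implemented catalytically with the catalyst $\sigma$.
   Context: All systems are finite-dimensional. $S(\rho)=-\mathrm{Tr}[\rho\log_2\rho]$. For a quantum map $\Phi$ on $A$, $S^G(\Phi)=\max_\rho[S((\mathcal{I}\otimes\Phi)(\rho))-S(\rho)]$ is its maximal global entropy production, the maximum being over all finite-dimensional reference systems $R$ and states $\rho$ on $RA$. A quantum map is completely positive and trace-preserving; it is unital if it preserves the maximally mixed state. A quantum map $\Phi$ on $A$ is implemented catalytically with the catalyst $\sigma_B$ (a state on $B$) if there are a unitary $U$ on $AB$ and a unitary $V$ on $B$ with $\mathrm{Tr}_B\,U(\rho_A\otimes\sigma_B)U^\dagger=\Phi(\rho)$ and $\mathrm{Tr}_A\,U(\rho_A\otimes\sigma_B)U^\dagger=V\sigma_BV^\dagger$ for all states $\rho$ on $A$. For $\sigma=\sum_i\lambda_i\Pi_i$ with distinct eigenvalues $\lambda_i$ and eigenspace projectors $\Pi_i$ of rank $r_i$, the catalytic entropy is $S^\diamond(\sigma)=-\sum_i\lambda_ir_i\log_2(\lambda_i/r_i)$. *)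

theory Defs
  imports
    Complex_Main
    "Jordan_Normal_Form.Spectral_Radius"
    "Jordan_Normal_Form.Schur_Decomposition"
    "Jordan_Normal_Form.DL_Rank"
begin

text \<open>
  A system of dimension \<open>d\<close> is the space \<open>\<complex>\<^sup>d\<close>, and operators on it are the elements
  of \<open>carrier_mat d d\<close>. In a composite system of dimensions \<open>m\<close> and \<open>n\<close> the pair of
  basis indices \<open>(i, k)\<close> is encoded as \<open>i * n + k\<close>.
\<close>

definition mat_trace :: "complex mat \<Rightarrow> complex" where
  "mat_trace A = (\<Sum>i<dim_row A. A $$ (i, i))"

definition hermitian_mat :: "nat \<Rightarrow> complex mat \<Rightarrow> bool" where
  "hermitian_mat n A \<longleftrightarrow> A \<in> carrier_mat n n \<and> mat_adjoint A = A"

definition psd_mat :: "nat \<Rightarrow> complex mat \<Rightarrow> bool" where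
  "psd_mat n A \<longleftrightarrow> hermitian_mat n A \<and> (\<forall>v \<in> carrier_vec n. 0 \<le> Re ((A *\<^sub>v v) \<bullet>c v))"

definition unitary_mat :: "nat \<Rightarrow> complex mat \<Rightarrow> bool" where
  "unitary_mat n U \<longleftrightarrow> U \<in> carrier_mat n n \<and>
     mat_adjoint U * U = 1\<^sub>m n \<and> U * mat_adjoint U = 1\<^sub>m n"

definition quantum_state :: "nat \<Rightarrow> complex mat \<Rightarrow> bool" where
  "quantum_state n \<rho> \<longleftrightarrow> psd_mat n \<rho> \<and> mat_trace \<rho> = 1"

definition kron :: "complex mat \<Rightarrow> complex mat \<Rightarrow> complex mat" where
  "kron A B = mat (dim_row A * dim_row B) (dim_col A * dim_col B)
     (\<lambda>(r, c). A $$ (r div dim_row B, c div dim_col B) * B $$ (r mod dim_row B, c mod dim_col B))"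

definition ptrace_fst :: "nat \<Rightarrow> nat \<Rightarrow> complex mat \<Rightarrow> complex mat" where
  "ptrace_fst m n M = mat n n (\<lambda>(k, l). \<Sum>i<m. M $$ (i * n + k, i * n + l))"

definition ptrace_snd :: "nat \<Rightarrow> nat \<Rightarrow> complex mat \<Rightarrow> complex mat" where
  "ptrace_snd m n M = mat m m (\<lambda>(i, j). \<Sum>k<n. M $$ (i * n + k, j * n + k))"

definition mat_unit :: "nat \<Rightarrow> nat \<Rightarrow> nat \<Rightarrow> complex mat" where
  "mat_unit n i j = mat n n (\<lambda>(a, b). if a = i \<and> b = j then 1 else 0)"

text \<open>
  The tensor product of two linear maps on operators: expand the argument in the basis
  \<open>kron (mat_unit m i j) (mat_unit n k l)\<close> and extend linearly.
\<close>

definition map_tensor ::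
    "nat \<Rightarrow> nat \<Rightarrow> (complex mat \<Rightarrow> complex mat) \<Rightarrow> (complex mat \<Rightarrow> complex mat)
       \<Rightarrow> complex mat \<Rightarrow> complex mat" where
  "map_tensor m n \<Phi> \<Psi> M = mat (m * n) (m * n)
     (\<lambda>(r, c). \<Sum>i<m. \<Sum>j<m. \<Sum>k<n. \<Sum>l<n.
        M $$ (i * n + k, j * n + l) * kron (\<Phi> (mat_unit m i j)) (\<Psi> (mat_unit n k l)) $$ (r, c))"

definition linear_on_mats :: "nat \<Rightarrow> (complex mat \<Rightarrow> complex mat) \<Rightarrow> bool" where
  "linear_on_mats n \<Phi> \<longleftrightarrow>
     (\<forall>A \<in> carrier_mat n n. \<Phi> A \<in> carrier_mat n n) \<and>
     (\<forall>A \<in> carrier_mat n n. \<forall>B \<in> carrier_mat n n. \<Phi> (A + B) = \<Phi> A + \<Phi> B) \<and>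
     (\<forall>c. \<forall>A \<in> carrier_mat n n. \<Phi> (c \<cdot>\<^sub>m A) = c \<cdot>\<^sub>m \<Phi> A)"

definition completely_positive :: "nat \<Rightarrow> (complex mat \<Rightarrow> complex mat) \<Rightarrow> bool" where
  "completely_positive n \<Phi> \<longleftrightarrow>
     (\<forall>r M. psd_mat (r * n) M \<longrightarrow> psd_mat (r * n) (map_tensor r n (\<lambda>X. X) \<Phi> M))"

definition trace_preserving :: "nat \<Rightarrow> (complex mat \<Rightarrow> complex mat) \<Rightarrow> bool" where
  "trace_preserving n \<Phi> \<longleftrightarrow> (\<forall>A \<in> carrier_mat n n. mat_trace (\<Phi> A) = mat_trace A)"

definition quantum_map :: "nat \<Rightarrow> (complex mat \<Rightarrow> complex mat) \<Rightarrow> bool" where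
  "quantum_map n \<Phi> \<longleftrightarrow>
     linear_on_mats n \<Phi> \<and> completely_positive n \<Phi> \<and> trace_preserving n \<Phi>"

definition max_mixed :: "nat \<Rightarrow> complex mat" where
  "max_mixed n = (1 / of_nat n) \<cdot>\<^sub>m 1\<^sub>m n"

definition unital :: "nat \<Rightarrow> (complex mat \<Rightarrow> complex mat) \<Rightarrow> bool" where
  "unital n \<Phi> \<longleftrightarrow> \<Phi> (max_mixed n) = max_mixed n"

text \<open>
  The orthogonal projector onto the \<open>\<mu>\<close>-eigenspace; it is the unique Hermitian idempotent
  whose range, i.e. whose set of fixed vectors, is that eigenspace.
\<close>

definition eigenprojector :: "complex mat \<Rightarrow> complex \<Rightarrow> complex mat" where
  "eigenprojector A \<mu> = (THE P. hermitian_mat (dim_row A) P \<and> P * P = P \<and>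
     (\<forall>v \<in> carrier_vec (dim_row A). P *\<^sub>v v = v \<longleftrightarrow> A *\<^sub>v v = \<mu> \<cdot>\<^sub>v v))"

text \<open>
  Functional calculus \<open>f(A) = \<Sum>\<^sub>\<mu> f(\<mu>) \<Pi>\<^sub>\<mu>\<close> for Hermitian \<open>A\<close>, whose eigenvalues are real.
\<close>

definition hermitian_fun :: "(real \<Rightarrow> real) \<Rightarrow> complex mat \<Rightarrow> complex mat" where
  "hermitian_fun f A = mat (dim_row A) (dim_row A)
     (\<lambda>(i, j). \<Sum>\<mu> \<in> spectrum A. complex_of_real (f (Re \<mu>)) * eigenprojector A \<mu> $$ (i, j))"

text \<open>
  Since \<open>log 2 0 = 0\<close>, and the eigenvalue \<open>0\<close> is in any case multiplied by \<open>0\<close> in both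
  entropies below, the convention \<open>0 log 0 = 0\<close> is respected.
\<close>

definition vn_entropy :: "complex mat \<Rightarrow> real" where
  "vn_entropy \<rho> = - Re (mat_trace (\<rho> * hermitian_fun (log 2) \<rho>))"

definition catalytic_entropy :: "complex mat \<Rightarrow> real" where
  "catalytic_entropy \<sigma> = - (\<Sum>\<mu> \<in> spectrum \<sigma>.
     let r = real (vec_space.rank (dim_row \<sigma>) (eigenprojector \<sigma> \<mu>))
     in Re \<mu> * r * log 2 (Re \<mu> / r))"

text \<open>
  For a quantum map the set below has a maximum (attained with a reference system of the
  dimension of the input), so its supremum is that maximum.
\<close>

definition global_entropy_production :: "nat \<Rightarrow> (complex mat \<Rightarrow> complex mat) \<Rightarrow> real" where
  "global_entropy_production n \<Phi> =
     Sup {vn_entropy (map_tensor r n (\<lambda>X. X) \<Phi> \<rho>) - vn_entropy \<rho> | r \<rho>. quantum_state (r * n) \<rho>}"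

definition implemented_catalytically ::
    "nat \<Rightarrow> (complex mat \<Rightarrow> complex mat) \<Rightarrow> nat \<Rightarrow> complex mat \<Rightarrow> bool" where
  "implemented_catalytically a \<Phi> b \<sigma> \<longleftrightarrow>
     (\<exists>U V. unitary_mat (a * b) U \<and> unitary_mat b V \<and>
        (\<forall>\<rho>. quantum_state a \<rho> \<longrightarrow>
           ptrace_snd a b (U * kron \<rho> \<sigma> * mat_adjoint U) = \<Phi> \<rho> \<and>
           ptrace_fst a b (U * kron \<rho> \<sigma> * mat_adjoint U) = V * \<sigma> * mat_adjoint V))"

end

theory Submission
  imports Defs
begin

text \<open>
  Let \<open>U\<close> implement \<open>\<Phi> = \<Psi>\<^sub>1 \<otimes> \<Psi>\<^sub>2\<close> with the catalyst \<open>\<sigma> = \<Sum> s\<^sub>k f\<^sub>k f\<^sub>k\<^sup>*\<close>. Absorbing \<open>V\<close> into \<open>U\<close>, the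
  catalyst condition on the maximally mixed input forces \<open>U\<close> to commute with \<open>1 \<otimes> \<sigma>\<close>. An input
  \<open>\<Sum> q\<^sub>t g\<^sub>t g\<^sub>t\<^sup>*\<close> is thus mapped to a mixture of the vectors \<open>\<langle>f\<^sub>l|U|g\<^sub>t f\<^sub>k\<rangle>\<close> with weights
  \<open>q\<^sub>t s\<^sub>k\<close>, where only those \<open>l\<close> with \<open>s\<^sub>l = s\<^sub>k\<close> contribute. The von Neumann entropy is at most the
  Shannon entropy of the squared norms of such a mixture, and each eigenspace of dimension
  \<open>r\<close> contributes at most \<open>log r\<close>; so the entropy production is at most the catalytic entropy.
  For product inputs the entropy productions of \<open>\<Psi>\<^sub>1\<close> and \<open>\<Psi>\<^sub>2\<close> add up.
\<close>

subsection \<open>Entropy of ensembles\<close>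

text \<open>The bound is H(s) + sum of s_k log r_k, with r_k the multiplicity of s_k: the catalyst
  level at the input contributes at most H(s), and the level found at the output, confined to the
  same eigenspace, at most log r_k. Writing log(s_k / r_k) as a difference shows that this is
  exactly the catalytic entropy. Two gaps shape the proof. An implementation is only specified on
  states of the joint input system, whereas entropy production involves references; hence the
  implementation has to be turned into an identity of coefficients on matrix units, by polarization.
  Moreover, two inputs with their references are naturally ordered as reference, input, reference,
  input, while the unitary acts on both inputs jointly; hence the entropy bound is stated for sums
  over abstract index sets instead of matrices, and the reordering is done on the indices of product
  bases.\<close>

lemma log_ratio_le:
  fixes x y :: real
  assumes "0 < x" "0 < y"
  shows "log 2 x - log 2 y \<le> (x / y - 1) / ln 2"
proof -
  have "ln x - ln y \<le> x / y - 1"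
    using ln_le_minus_one[of "x / y"] assms by (simp add: ln_div)
  then show ?thesis
    by (simp add: log_def divide_right_mono flip: diff_divide_distrib)
qed

text \<open>The squared moduli \<open>a m k\<close> have row sums \<open>lam m\<close> and column
  sums \<open>w k\<close>, so the difference of the two sides is the sum of
  \<open>a m k * (log 2 (w k) - log 2 (lam m))\<close>. Up to the factor 1 / ln 2, the bound ln t <=
  t - 1 estimates it by the sum of \<open>w k * (a m k / lam m) - a m k\<close>, which Bessel's
  inequality for the orthogonal rows makes nonpositive. If \<open>lam m\<close> is 0 the row
  vanishes, and division by zero gives 0.\<close>

lemma gram_entropy_le:
  fixes c :: "'m \<Rightarrow> 'k \<Rightarrow> complex" and lam :: "'m \<Rightarrow> real"
  assumes fin: "finite M" "finite K"
    and gram: "\<And>m n. m \<in> M \<Longrightarrow> n \<in> M \<Longrightarrow>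
      (\<Sum>k\<in>K. c m k * cnj (c n k)) = (if m = n then of_real (lam m) else 0)"
    and w: "\<And>k. k \<in> K \<Longrightarrow> w k = (\<Sum>m\<in>M. (cmod (c m k))\<^sup>2)"
  shows "(\<Sum>k\<in>K. w k * log 2 (w k)) \<le> (\<Sum>m\<in>M. lam m * log 2 (lam m))"
proof -
  define a where "a m k = (cmod (c m k))\<^sup>2" for m k
  have a_nn: "0 \<le> a m k" for m k by (simp add: a_def)
  have a_cnj: "complex_of_real (a m k) = c m k * cnj (c m k)" for m k
    unfolding a_def by (rule complex_norm_square)
  have lam: "lam m = (\<Sum>k\<in>K. a m k)" if "m \<in> M" for m
  proof -
    have "complex_of_real (lam m) = of_real (\<Sum>k\<in>K. a m k)"
      using gram[OF that that] by (simp add: a_cnj)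
    then show ?thesis using of_real_eq_iff by blast
  qed
  have w': "w k = (\<Sum>m\<in>M. a m k)" if "k \<in> K" for k
    using w[OF that] by (simp add: a_def)
  have bessel: "(\<Sum>m\<in>M. a m k / lam m) \<le> 1" if k: "k \<in> K" for k
  proof -
    define t where "t = (\<Sum>m\<in>M. a m k / lam m)"
    \<comment> \<open>\<open>al\<close> is the orthogonal projection of the \<open>k\<close>-th unit
      vector onto the span of the rows of \<open>c\<close>. Its \<open>k\<close>-th coordinate and
      its squared norm both equal \<open>t\<close>, whence \<open>t\<^sup>2 \<le> t\<close>.\<close>
    define al where "al l = (\<Sum>m\<in>M. cnj (c m k) / of_real (lam m) * c m l)" for l
    have alk: "al k = of_real t"
      by (simp add: al_def t_def a_cnj mult.commute)
    have "of_real (\<Sum>l\<in>K. (cmod (al l))\<^sup>2) = (\<Sum>l\<in>K. al l * cnj (al l))"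
      unfolding of_real_sum by (rule sum.cong[OF refl], rule complex_norm_square)
    also have "\<dots> = (\<Sum>l\<in>K. \<Sum>m\<in>M. \<Sum>n\<in>M.
        cnj (c m k) / of_real (lam m) * (c n k / of_real (lam n)) * (c m l * cnj (c n l)))"
      by (simp add: al_def cnj_sum sum_product mult_ac)
    also have "\<dots> = (\<Sum>m\<in>M. \<Sum>n\<in>M. \<Sum>l\<in>K.
        cnj (c m k) / of_real (lam m) * (c n k / of_real (lam n)) * (c m l * cnj (c n l)))"
      by (subst sum.swap, rule sum.cong[OF refl], rule sum.swap)
    also have "\<dots> = (\<Sum>m\<in>M. \<Sum>n\<in>M.
        cnj (c m k) / of_real (lam m) * (c n k / of_real (lam n)) * (if m = n then of_real (lam m) else 0))"
      by (intro sum.cong refl) (simp only: gram flip: sum_distrib_left)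
    also have "\<dots> = (\<Sum>m\<in>M. \<Sum>n\<in>M. if n = m then
        cnj (c m k) / of_real (lam m) * (c m k / of_real (lam m)) * of_real (lam m) else 0)"
      by (intro sum.cong refl) auto
    also have "\<dots> = (\<Sum>m\<in>M.
        cnj (c m k) / of_real (lam m) * (c m k / of_real (lam m)) * of_real (lam m))"
      using fin by (simp add: sum.delta)
    also have "\<dots> = (\<Sum>m\<in>M. of_real (a m k / lam m))"
      by (rule sum.cong[OF refl]) (simp add: a_cnj)
    also have "\<dots> = of_real t" by (simp add: t_def)
    finally have tt: "(\<Sum>l\<in>K. (cmod (al l))\<^sup>2) = t" using of_real_eq_iff by blast
    have "t\<^sup>2 = (cmod (al k))\<^sup>2" by (simp add: alk)
    also have "\<dots> \<le> (\<Sum>l\<in>K. (cmod (al l))\<^sup>2)"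
      by (rule member_le_sum) (use k fin in auto)
    finally have "t * t \<le> t" using tt by (simp add: power2_eq_square)
    then have "t \<le> 1" using mult_strict_left_mono[of 1 t t] by (cases "1 < t") auto
    then show ?thesis by (simp add: t_def)
  qed
  \<comment> \<open>A nonzero \<open>a m k\<close> is a lower bound for both \<open>w k\<close> and
    \<open>lam m\<close>, so both logarithms have positive arguments.\<close>
  have tm: "a m k * log 2 (w k) - a m k * log 2 (lam m) \<le> (w k * (a m k / lam m) - a m k) / ln 2"
    if m: "m \<in> M" and k: "k \<in> K" for m k
  proof (cases "a m k = 0")
    case True
    then show ?thesis by simp
  next
    case False
    then have pos: "0 < a m k" using a_nn[of m k] by simp
    have "a m k \<le> w k" unfolding w'[OF k] by (rule member_le_sum) (use m fin a_nn in auto)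
    moreover have "a m k \<le> lam m" unfolding lam[OF m] by (rule member_le_sum) (use k fin a_nn in auto)
    ultimately have "a m k * (log 2 (w k) - log 2 (lam m)) \<le> a m k * ((w k / lam m - 1) / ln 2)"
      using pos by (intro mult_left_mono log_ratio_le) auto
    then show ?thesis by (simp add: algebra_simps)
  qed
  have "(\<Sum>k\<in>K. w k * log 2 (w k)) - (\<Sum>m\<in>M. lam m * log 2 (lam m))
      = (\<Sum>k\<in>K. \<Sum>m\<in>M. a m k * log 2 (w k)) - (\<Sum>m\<in>M. \<Sum>k\<in>K. a m k * log 2 (lam m))"
    by (intro arg_cong2[where f = "(-)"] sum.cong refl)
       (simp_all only: w' lam flip: sum_distrib_right)
  also have "\<dots> = (\<Sum>k\<in>K. \<Sum>m\<in>M. a m k * log 2 (w k) - a m k * log 2 (lam m))"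
    by (subst (2) sum.swap) (simp add: sum_subtractf)
  also have "\<dots> \<le> (\<Sum>k\<in>K. \<Sum>m\<in>M. (w k * (a m k / lam m) - a m k) / ln 2)"
    by (intro sum_mono tm)
  also have "\<dots> = (\<Sum>k\<in>K. w k * (\<Sum>m\<in>M. a m k / lam m) - w k) / ln 2"
    by (simp add: sum_subtractf sum_distrib_left flip: sum_divide_distrib w')
  also have "\<dots> \<le> 0"
  proof -
    have "w k * (\<Sum>m\<in>M. a m k / lam m) - w k \<le> 0" if "k \<in> K" for k
    proof -
      have "0 \<le> w k" unfolding w'[OF that] by (intro sum_nonneg a_nn)
      then show ?thesis using mult_left_mono[OF bessel[OF that], of "w k"] by simp
    qed
    then show ?thesis by (intro divide_nonpos_pos sum_nonpos) auto
  qed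
  finally show ?thesis by simp
qed

text \<open>In the array \<open>c\<close> of coordinates of the vectors \<open>u k\<close> along the
  eigenvectors \<open>e m\<close>, the equality of the two decompositions makes the rows orthogonal
  with squared norms \<open>lam m\<close>, and Parseval gives the columns the squared norms
  \<open>w k\<close>. The index set \<open>X\<close> is arbitrary so that tuples can index a
  composite system.\<close>

lemma spectral_entropy_le_ensemble:
  fixes e :: "'m \<Rightarrow> 'x \<Rightarrow> complex" and u :: "'k \<Rightarrow> 'x \<Rightarrow> complex" and lam :: "'m \<Rightarrow> real"
  assumes fin: "finite M" "finite K" "finite X"
    and orth: "\<And>m n. m \<in> M \<Longrightarrow> n \<in> M \<Longrightarrow> (\<Sum>x\<in>X. e m x * cnj (e n x)) = (if m = n then 1 else 0)"
    and compl: "\<And>x y. x \<in> X \<Longrightarrow> y \<in> X \<Longrightarrow> (\<Sum>m\<in>M. e m x * cnj (e m y)) = (if x = y then 1 else 0)"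
    and eq: "\<And>x y. x \<in> X \<Longrightarrow> y \<in> X \<Longrightarrow>
      (\<Sum>m\<in>M. of_real (lam m) * (e m x * cnj (e m y))) = (\<Sum>k\<in>K. u k x * cnj (u k y))"
    and w: "\<And>k. k \<in> K \<Longrightarrow> w k = (\<Sum>x\<in>X. (cmod (u k x))\<^sup>2)"
  shows "- (\<Sum>m\<in>M. lam m * log 2 (lam m)) \<le> - (\<Sum>k\<in>K. w k * log 2 (w k))"
proof -
  define c where "c m k = (\<Sum>x\<in>X. u k x * cnj (e m x))" for m k
  have "(\<Sum>k\<in>K. w k * log 2 (w k)) \<le> (\<Sum>m\<in>M. lam m * log 2 (lam m))"
  proof (rule gram_entropy_le[OF fin(1,2), of c])
    fix m n assume m: "m \<in> M" and n: "n \<in> M"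
    have "(\<Sum>k\<in>K. c m k * cnj (c n k))
        = (\<Sum>k\<in>K. \<Sum>x\<in>X. \<Sum>y\<in>X. (cnj (e m x) * e n y) * (u k x * cnj (u k y)))"
      by (simp only: c_def cnj_sum sum_product, simp only: complex_cnj_mult complex_cnj_cnj mult_ac)
    also have "\<dots> = (\<Sum>x\<in>X. \<Sum>y\<in>X. \<Sum>k\<in>K. (cnj (e m x) * e n y) * (u k x * cnj (u k y)))"
      by (subst sum.swap, rule sum.cong[OF refl], rule sum.swap)
    also have "\<dots> = (\<Sum>x\<in>X. \<Sum>y\<in>X. (cnj (e m x) * e n y) * (\<Sum>l\<in>M. of_real (lam l) * (e l x * cnj (e l y))))"
      by (intro sum.cong refl) (simp only: eq sum_distrib_left)
    also have "\<dots> = (\<Sum>x\<in>X. \<Sum>y\<in>X. \<Sum>l\<in>M. of_real (lam l) * ((e l x * cnj (e m x)) * (e n y * cnj (e l y))))"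
      by (simp add: sum_distrib_left mult_ac)
    also have "\<dots> = (\<Sum>x\<in>X. \<Sum>l\<in>M. \<Sum>y\<in>X. of_real (lam l) * ((e l x * cnj (e m x)) * (e n y * cnj (e l y))))"
      by (rule sum.cong[OF refl], rule sum.swap)
    also have "\<dots> = (\<Sum>l\<in>M. \<Sum>x\<in>X. \<Sum>y\<in>X. of_real (lam l) * ((e l x * cnj (e m x)) * (e n y * cnj (e l y))))"
      by (rule sum.swap)
    also have "\<dots> = (\<Sum>l\<in>M. of_real (lam l) * ((\<Sum>x\<in>X. e l x * cnj (e m x)) * (\<Sum>y\<in>X. e n y * cnj (e l y))))"
      by (rule sum.cong[OF refl], subst sum_product, simp only: sum_distrib_left)
    also have "\<dots> = (\<Sum>l\<in>M. if l = m then (if m = n then of_real (lam m) else 0) else 0)"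
      by (rule sum.cong[OF refl]) (auto simp: orth m n)
    also have "\<dots> = (if m = n then of_real (lam m) else 0)"
      using m fin by simp
    finally show "(\<Sum>k\<in>K. c m k * cnj (c n k)) = (if m = n then of_real (lam m) else 0)" .
  next
    fix k assume k: "k \<in> K"
    have "complex_of_real (\<Sum>m\<in>M. (cmod (c m k))\<^sup>2) = (\<Sum>m\<in>M. c m k * cnj (c m k))"
      unfolding of_real_sum by (rule sum.cong[OF refl], rule complex_norm_square)
    also have "\<dots> = (\<Sum>m\<in>M. \<Sum>x\<in>X. \<Sum>y\<in>X. (u k x * cnj (u k y)) * (e m y * cnj (e m x)))"
      by (simp only: c_def cnj_sum sum_product, simp only: complex_cnj_mult complex_cnj_cnj mult_ac)
    also have "\<dots> = (\<Sum>x\<in>X. \<Sum>y\<in>X. \<Sum>m\<in>M. (u k x * cnj (u k y)) * (e m y * cnj (e m x)))"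
      by (subst sum.swap, rule sum.cong[OF refl], rule sum.swap)
    also have "\<dots> = (\<Sum>x\<in>X. \<Sum>y\<in>X. if y = x then u k x * cnj (u k x) else 0)"
      by (intro sum.cong refl) (auto simp: compl simp flip: sum_distrib_left)
    also have "\<dots> = (\<Sum>x\<in>X. u k x * cnj (u k x))"
      using fin by simp
    also have "\<dots> = of_real (w k)"
      unfolding w[OF k] of_real_sum by (rule sum.cong[OF refl], rule complex_norm_square[symmetric])
    finally show "w k = (\<Sum>m\<in>M. (cmod (c m k))\<^sup>2)" using of_real_eq_iff by metis
  qed
  then show ?thesis by simp
qed

text \<open>Comparison with the mass \<open>Q\<close> spread uniformly over \<open>B\<close>: the
  linear bounds on the single terms sum to zero because both distributions have the same mass.
  \<open>Q\<close> need not be 1, as the lemma serves the weights that share one input vector and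
  one catalyst level.\<close>

lemma block_entropy_le:
  fixes w :: "'l \<Rightarrow> real"
  assumes fin: "finite L" and B: "B \<subseteq> L" "B \<noteq> {}"
    and nn: "\<And>l. l \<in> L \<Longrightarrow> 0 \<le> w l" and supp: "\<And>l. l \<in> L \<Longrightarrow> l \<notin> B \<Longrightarrow> w l = 0"
    and Q: "(\<Sum>l\<in>L. w l) = Q"
  shows "- (\<Sum>l\<in>L. w l * log 2 (w l)) \<le> Q * log 2 (real (card B)) - Q * log 2 Q"
proof -
  have finB: "finite B" using B fin finite_subset by blast
  then have r: "0 < real (card B)" using B by (simp add: card_gt_0_iff)
  have sumB: "(\<Sum>l\<in>B. w l) = Q"
    unfolding Q[symmetric] by (rule sum.mono_neutral_left) (use fin B supp in auto)
  have eqB: "(\<Sum>l\<in>L. w l * log 2 (w l)) = (\<Sum>l\<in>B. w l * log 2 (w l))"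
    by (rule sum.mono_neutral_right) (use fin B supp in auto)
  have tm: "w l * (log 2 Q - log 2 (card B) - log 2 (w l)) \<le> (Q / card B - w l) / ln 2"
    if l: "l \<in> B" for l
  proof (cases "w l = 0")
    case True
    have "0 \<le> Q" unfolding sumB[symmetric] using nn B by (intro sum_nonneg) auto
    with True show ?thesis by simp
  next
    case False
    then have pos: "0 < w l" using nn B l by (metis order_le_less subsetD)
    have "w l \<le> Q" unfolding sumB[symmetric] by (rule member_le_sum) (use l finB nn B in auto)
    then have Qp: "0 < Q" using pos by simp
    have "w l * (log 2 (Q / card B) - log 2 (w l)) \<le> w l * ((Q / card B / w l - 1) / ln 2)"
      using pos Qp r by (intro mult_left_mono log_ratio_le) auto
    also have "w l * ((Q / card B / w l - 1) / ln 2) = (Q / card B - w l) / ln 2"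
      using pos by (simp add: right_diff_distrib)
    finally show ?thesis using Qp r by (simp add: log_divide)
  qed
  have "(\<Sum>l\<in>B. w l * (log 2 Q - log 2 (card B) - log 2 (w l))) \<le> (\<Sum>l\<in>B. (Q / card B - w l) / ln 2)"
    by (intro sum_mono tm)
  also have "\<dots> = 0" using r by (simp add: sum_subtractf sumB flip: sum_divide_distrib)
  finally show ?thesis
    by (simp add: eqB right_diff_distrib sum_subtractf sumB algebra_simps flip: sum_distrib_left sum_distrib_right)
qed

lemma product_entropy:
  fixes p :: "'i \<Rightarrow> real" and q :: "'j \<Rightarrow> real"
  assumes nn: "\<And>i. i \<in> I \<Longrightarrow> 0 \<le> p i" "\<And>j. j \<in> J \<Longrightarrow> 0 \<le> q j"
    and one: "sum p I = 1" "sum q J = 1"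
  shows "(\<Sum>i\<in>I. \<Sum>j\<in>J. p i * q j * log 2 (p i * q j))
    = (\<Sum>i\<in>I. p i * log 2 (p i)) + (\<Sum>j\<in>J. q j * log 2 (q j))"
proof -
  \<comment> \<open>The logarithm of a product splits only for positive factors; a zero weight
    annihilates both sides.\<close>
  have "p i * q j * log 2 (p i * q j) = p i * log 2 (p i) * q j + p i * (q j * log 2 (q j))"
    if "i \<in> I" "j \<in> J" for i j
    using nn(1)[of i] nn(2)[of j] that by (cases "p i = 0"; cases "q j = 0") (simp_all add: log_mult algebra_simps)
  then have "(\<Sum>i\<in>I. \<Sum>j\<in>J. p i * q j * log 2 (p i * q j))
      = (\<Sum>i\<in>I. \<Sum>j\<in>J. p i * log 2 (p i) * q j + p i * (q j * log 2 (q j)))"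
    by simp
  also have "\<dots> = (\<Sum>i\<in>I. p i * log 2 (p i)) + (\<Sum>j\<in>J. q j * log 2 (q j))"
    by (simp add: sum.distrib one flip: sum_distrib_left sum_distrib_right)
  finally show ?thesis .
qed

subsection \<open>Spectral theorem\<close>

lemma mat_adjoint_carrier [simp]:
  "A \<in> carrier_mat n m \<Longrightarrow> mat_adjoint A \<in> carrier_mat m n"
  by (auto simp: mat_adjoint_def mat_of_rows_def)

lemma dim_mat_adjoint [simp]:
  "dim_row (mat_adjoint A) = dim_col A" "dim_col (mat_adjoint A) = dim_row A"
  by (auto simp: mat_adjoint_def mat_of_rows_def)

lemma mat_adjoint_index [simp]:
  fixes A :: "complex mat"
  shows "i < dim_col A \<Longrightarrow> j < dim_row A \<Longrightarrow> mat_adjoint A $$ (i, j) = cnj (A $$ (j, i))"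
  by (simp add: mat_adjoint_def mat_of_rows_def cols_def vec_of_list_index)

lemma mat_mult_index:
  assumes "A \<in> carrier_mat n m" "B \<in> carrier_mat m p" "i < n" "j < p"
  shows "(A * B) $$ (i, j) = (\<Sum>k<m. A $$ (i, k) * B $$ (k, j))"
  using assms by (simp add: scalar_prod_def lessThan_atLeast0)

lemma mat_vec_index:
  assumes "A \<in> carrier_mat n m" "v \<in> carrier_vec m" "i < n"
  shows "(A *\<^sub>v v) $ i = (\<Sum>k<m. A $$ (i, k) * v $ k)"
  using assms by (simp add: scalar_prod_def lessThan_atLeast0)

lemma mat_trace_mult_comm:
  assumes A: "A \<in> carrier_mat n m" and B: "B \<in> carrier_mat m n"
  shows "mat_trace (A * B) = mat_trace (B * A)"
proof -
  have "mat_trace (A * B) = (\<Sum>i<n. \<Sum>k<m. A $$ (i, k) * B $$ (k, i))"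
    using A by (simp add: mat_trace_def mat_mult_index[OF A B] del: index_mult_mat(1))
  also have "\<dots> = (\<Sum>k<m. \<Sum>i<n. B $$ (k, i) * A $$ (i, k))"
    by (subst sum.swap) (simp add: mult.commute)
  also have "\<dots> = mat_trace (B * A)"
    using B by (simp add: mat_trace_def mat_mult_index[OF B A] del: index_mult_mat(1))
  finally show ?thesis .
qed

text \<open>Self-adjointness in coordinates; it yields both the orthogonality of eigenvectors and
  the reality of eigenvalues.\<close>

lemma hermitian_form_swap:
  fixes M :: "complex mat"
  assumes "\<And>x y. x < n \<Longrightarrow> y < n \<Longrightarrow> cnj (M $$ (x, y)) = M $$ (y, x)"
  shows "(\<Sum>x<n. (\<Sum>y<n. M $$ (x, y) * w y) * cnj (z x)) = (\<Sum>y<n. w y * cnj (\<Sum>x<n. M $$ (y, x) * z x))"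
proof -
  have "(\<Sum>x<n. (\<Sum>y<n. M $$ (x, y) * w y) * cnj (z x)) = (\<Sum>x<n. \<Sum>y<n. w y * cnj (M $$ (y, x) * z x))"
    unfolding sum_distrib_right by (intro sum.cong refl) (simp add: assms)
  also have "\<dots> = (\<Sum>y<n. w y * cnj (\<Sum>x<n. M $$ (y, x) * z x))"
    by (subst sum.swap) (simp only: cnj_sum sum_distrib_left)
  finally show ?thesis .
qed

text \<open>The Schur form has the roots of the characteristic polynomial on its diagonal, so the
  trace is their sum. If every root were \<open>c\<close>, this sum would be
  \<open>n * c\<close>.\<close>

lemma exists_eigenvalue_ne:
  fixes B :: "complex mat" and c :: complex
  assumes B: "B \<in> carrier_mat n n" and tr: "mat_trace B \<noteq> of_nat n * c"
  shows "\<exists>\<mu>. eigenvalue B \<mu> \<and> \<mu> \<noteq> c"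
proof (rule ccontr)
  assume none: "\<not> ?thesis"
  obtain es where es: "char_poly B = (\<Prod>a\<leftarrow>es. [:- a, 1:])" "length es = n"
    using char_poly_factorized[OF B] by blast
  have "a = c" if "a \<in> set es" for a
  proof -
    have "poly (char_poly B) a = 0"
      using that unfolding es(1) by (induction es) auto
    then show ?thesis using none eigenvalue_root_char_poly[OF B] by blast
  qed
  then have sl: "sum_list es = of_nat n * c"
    using es(2) by (metis replicate_length_same sum_list_replicate)
  obtain C P Q where "schur_decomposition B es = (C, P, Q)"
    by (cases "schur_decomposition B es")
  from schur_decomposition[OF B es(1) this]
  have sim: "similar_mat_wit B C P Q" and dC: "diag_mat C = es" by auto
  note w = similar_mat_witD2[OF B sim]
  have "mat_trace B = mat_trace (P * (C * Q))" using w by (simp add: assoc_mult_mat)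
  also have "\<dots> = mat_trace ((C * Q) * P)" using w by (intro mat_trace_mult_comm) auto
  also have "(C * Q) * P = C" using w by (simp add: assoc_mult_mat[of C n n Q n P n])
  also have "mat_trace C = sum_list (diag_mat C)"
    by (simp add: mat_trace_def diag_mat_def interv_sum_list_conv_sum_set_nat lessThan_atLeast0)
  finally show False using tr sl dC by simp
qed

lemma hermitian_matD:
  assumes "hermitian_mat n A"
  shows "A \<in> carrier_mat n n" "\<And>x y. x < n \<Longrightarrow> y < n \<Longrightarrow> cnj (A $$ (x, y)) = A $$ (y, x)"
proof -
  show A: "A \<in> carrier_mat n n" using assms by (simp add: hermitian_mat_def)
  fix x y assume "x < n" "y < n"
  then show "cnj (A $$ (x, y)) = A $$ (y, x)"
    using A assms mat_adjoint_index[of y A x] by (simp add: hermitian_mat_def)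
qed

lemma hermitian_matI:
  assumes "A \<in> carrier_mat n n" "\<And>x y. x < n \<Longrightarrow> y < n \<Longrightarrow> cnj (A $$ (x, y)) = A $$ (y, x)"
  shows "hermitian_mat n A"
  unfolding hermitian_mat_def using assms by (auto intro!: eq_matI)

text \<open>Vectors are coordinate functions, which turns every later identity into a rearrangement
  of finite sums. Both orthonormality and completeness are recorded, since one contracts sums over
  coordinates and the other sums over eigenvectors. Eigenvalues are listed with
  multiplicity.\<close>

definition eigensystem :: "nat \<Rightarrow> complex mat \<Rightarrow> (nat \<Rightarrow> nat \<Rightarrow> complex) \<Rightarrow> (nat \<Rightarrow> real) \<Rightarrow> bool" where
  "eigensystem n A e lam \<longleftrightarrow> A \<in> carrier_mat n n \<and>
     (\<forall>i<n. \<forall>j<n. (\<Sum>x<n. e i x * cnj (e j x)) = (if i = j then 1 else 0)) \<and>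
     (\<forall>x<n. \<forall>y<n. (\<Sum>i<n. e i x * cnj (e i y)) = (if x = y then 1 else 0)) \<and>
     (\<forall>x<n. \<forall>y<n. A $$ (x, y) = (\<Sum>i<n. of_real (lam i) * (e i x * cnj (e i y))))"

definition partial_eigenbasis ::
    "nat \<Rightarrow> complex mat \<Rightarrow> nat \<Rightarrow> (nat \<Rightarrow> nat \<Rightarrow> complex) \<Rightarrow> (nat \<Rightarrow> real) \<Rightarrow> bool" where
  "partial_eigenbasis n A k e lam \<longleftrightarrow>
     (\<forall>i<k. \<forall>j<k. (\<Sum>x<n. e i x * cnj (e j x)) = (if i = j then 1 else 0)) \<and>
     (\<forall>i<k. \<forall>x<n. (\<Sum>y<n. A $$ (x, y) * e i y) = of_real (lam i) * e i x)"

text \<open>Moving the eigenvalues already found to a common value \<open>c\<close> of which the trace is not the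
  \<open>n\<close>-fold leaves an eigenvalue \<open>\<mu> \<noteq> c\<close>, whose eigenvectors are orthogonal to the old ones.\<close>

lemma partial_eigenbasis_extend:
  assumes H: "hermitian_mat n A" and pe: "partial_eigenbasis n A k e lam" and k: "k < n"
  shows "\<exists>v \<mu>. partial_eigenbasis n A (Suc k) (e(k := v)) (lam(k := \<mu>))"
proof -
  note A = hermitian_matD(1)[OF H] and Ah = hermitian_matD(2)[OF H]
  have orth: "(\<Sum>x<n. e i x * cnj (e j x)) = (if i = j then 1 else 0)" if "i < k" "j < k" for i j
    using pe that unfolding partial_eigenbasis_def by blast
  have eig: "(\<Sum>y<n. A $$ (x, y) * e i y) = of_real (lam i) * e i x" if "i < k" "x < n" for i x
    using pe that unfolding partial_eigenbasis_def by blast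
  define t where "t = Re (mat_trace A) - (\<Sum>i<k. lam i)"
  \<comment> \<open>The trace of \<open>B\<close> will be \<open>t + k * c\<close>, so it differs
    from \<open>n * c\<close> exactly if \<open>(n - k) * c\<close> differs from \<open>t\<close>;
    with this choice that product is \<open>t + 1\<close>.\<close>
  define c where "c = (t + 1) / (real n - real k)"
  have c: "(real n - real k) * c \<noteq> t" using k by (simp add: c_def)
  define B where "B = mat n n (\<lambda>(x, y). A $$ (x, y) + (\<Sum>i<k. of_real (c - lam i) * (e i x * cnj (e i y))))"
  have B: "B \<in> carrier_mat n n" by (simp add: B_def)
  have Bi: "B $$ (x, y) = A $$ (x, y) + (\<Sum>i<k. of_real (c - lam i) * (e i x * cnj (e i y)))"
    if "x < n" "y < n" for x y using that by (simp add: B_def)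
  have Bh: "cnj (B $$ (x, y)) = B $$ (y, x)" if "x < n" "y < n" for x y
    using that by (simp add: Bi Ah cnj_sum mult_ac)
  have Bv: "(\<Sum>y<n. B $$ (x, y) * v y) = (\<Sum>y<n. A $$ (x, y) * v y)
      + (\<Sum>i<k. of_real (c - lam i) * e i x * (\<Sum>y<n. v y * cnj (e i y)))" if "x < n" for x and v :: "nat \<Rightarrow> complex"
  proof -
    have "B $$ (x, y) * v y = A $$ (x, y) * v y
        + (\<Sum>i<k. of_real (c - lam i) * e i x * (v y * cnj (e i y)))" if "y < n" for y
      using \<open>x < n\<close> that by (simp only: Bi distrib_right sum_distrib_right) (simp add: mult_ac)
    then have "(\<Sum>y<n. B $$ (x, y) * v y) = (\<Sum>y<n. A $$ (x, y) * v y)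
        + (\<Sum>y<n. \<Sum>i<k. of_real (c - lam i) * e i x * (v y * cnj (e i y)))"
      by (simp add: sum.distrib)
    also have "(\<Sum>y<n. \<Sum>i<k. of_real (c - lam i) * e i x * (v y * cnj (e i y)))
        = (\<Sum>i<k. of_real (c - lam i) * e i x * (\<Sum>y<n. v y * cnj (e i y)))"
      by (subst sum.swap) (simp only: sum_distrib_left)
    finally show ?thesis .
  qed
  have Be: "(\<Sum>y<n. B $$ (x, y) * e i y) = of_real c * e i x" if "i < k" "x < n" for i x
  proof -
    have "(\<Sum>j<k. of_real (c - lam j) * e j x * (\<Sum>y<n. e i y * cnj (e j y)))
        = (\<Sum>j<k. if j = i then of_real (c - lam i) * e i x else 0)"
      by (rule sum.cong[OF refl]) (use that in \<open>auto simp: orth\<close>)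
    also have "\<dots> = of_real (c - lam i) * e i x" using that by simp
    finally show ?thesis using that by (simp only: Bv eig) (simp add: algebra_simps)
  qed
  have "mat_trace B = mat_trace A + (\<Sum>x<n. \<Sum>i<k. of_real (c - lam i) * (e i x * cnj (e i x)))"
    using A B by (simp add: mat_trace_def Bi sum.distrib)
  also have "(\<Sum>x<n. \<Sum>i<k. of_real (c - lam i) * (e i x * cnj (e i x)))
      = (\<Sum>i<k. of_real (c - lam i) * (\<Sum>x<n. e i x * cnj (e i x)))"
    by (subst sum.swap) (simp only: sum_distrib_left)
  also have "\<dots> = of_real (\<Sum>i<k. c - lam i)"
    unfolding of_real_sum by (rule sum.cong[OF refl]) (simp add: orth)
  finally have "Re (mat_trace B) = t + real k * c" by (simp add: t_def sum_subtractf)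
  then have "mat_trace B \<noteq> of_nat n * of_real c" using c by (auto simp: algebra_simps)
  from exists_eigenvalue_ne[OF B this] obtain \<mu> where "eigenvalue B \<mu>" and \<mu>c: "\<mu> \<noteq> of_real c"
    by blast
  then obtain w where w: "w \<in> carrier_vec n" "w \<noteq> 0\<^sub>v n" "B *\<^sub>v w = \<mu> \<cdot>\<^sub>v w"
    using B unfolding eigenvalue_def eigenvector_def by auto
  have Bw: "(\<Sum>y<n. B $$ (x, y) * w $ y) = \<mu> * w $ x" if "x < n" for x
    using mat_vec_index[OF B w(1) that] w that by simp
  \<comment> \<open>Both \<open>w\<close> and \<open>e i\<close> are eigenvectors of the Hermitian
    \<open>B\<close>, with the different eigenvalues \<open>\<mu>\<close> and \<open>c\<close>, the
    latter being real.\<close>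
  have ow: "(\<Sum>x<n. w $ x * cnj (e i x)) = 0" if i: "i < k" for i
  proof -
    have "\<mu> * (\<Sum>x<n. w $ x * cnj (e i x)) = (\<Sum>x<n. (\<mu> * w $ x) * cnj (e i x))"
      by (simp only: sum_distrib_left mult.assoc)
    also have "\<dots> = (\<Sum>x<n. (\<Sum>y<n. B $$ (x, y) * w $ y) * cnj (e i x))"
      by (rule sum.cong[OF refl]) (simp add: Bw)
    also have "\<dots> = (\<Sum>y<n. w $ y * cnj (\<Sum>x<n. B $$ (y, x) * e i x))"
      by (rule hermitian_form_swap[OF Bh])
    also have "\<dots> = (\<Sum>y<n. w $ y * cnj (of_real c * e i y))"
      by (rule sum.cong[OF refl]) (use i in \<open>simp add: Be\<close>)
    also have "\<dots> = of_real c * (\<Sum>x<n. w $ x * cnj (e i x))"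
      by (simp add: sum_distrib_left mult_ac)
    finally show ?thesis using \<mu>c by simp
  qed
  \<comment> \<open>On vectors orthogonal to all \<open>e i\<close> the matrix \<open>B\<close> acts
    as \<open>A\<close>, so \<open>w\<close> is an eigenvector of \<open>A\<close> itself.\<close>
  have Aw: "(\<Sum>y<n. A $$ (x, y) * w $ y) = \<mu> * w $ x" if "x < n" for x
    using Bv[OF that, of "\<lambda>y. w $ y"] Bw[OF that] ow by simp
  define N where "N = (\<Sum>x<n. (cmod (w $ x))\<^sup>2)"
  have "\<exists>x<n. w $ x \<noteq> 0" using w(1,2) by (metis carrier_vecD eq_vecI index_zero_vec(1,2))
  then obtain x0 where x0: "x0 < n" "w $ x0 \<noteq> 0" by blast
  then have "0 < (cmod (w $ x0))\<^sup>2" by simp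
  also have "\<dots> \<le> N" unfolding N_def by (rule member_le_sum) (use x0 in auto)
  finally have N: "0 < N" .
  have NC: "(\<Sum>x<n. w $ x * cnj (w $ x)) = of_real N"
    unfolding N_def of_real_sum by (rule sum.cong[OF refl], rule complex_norm_square[symmetric])
  \<comment> \<open>Moving \<open>A\<close> to the other side of its quadratic form at
    \<open>w\<close> replaces \<open>\<mu>\<close> by its conjugate; so the eigenvalue is real, as
    \<open>lam\<close> demands.\<close>
  have "\<mu> * of_real N = (\<Sum>x<n. (\<mu> * w $ x) * cnj (w $ x))"
    by (simp only: NC[symmetric] sum_distrib_left mult.assoc)
  also have "\<dots> = (\<Sum>x<n. (\<Sum>y<n. A $$ (x, y) * w $ y) * cnj (w $ x))"
    by (rule sum.cong[OF refl]) (simp add: Aw)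
  also have "\<dots> = (\<Sum>y<n. w $ y * cnj (\<Sum>x<n. A $$ (y, x) * w $ x))"
    by (rule hermitian_form_swap[OF Ah])
  also have "\<dots> = (\<Sum>y<n. cnj \<mu> * (w $ y * cnj (w $ y)))"
    by (rule sum.cong[OF refl]) (simp add: Aw)
  also have "\<dots> = cnj \<mu> * of_real N"
    by (simp only: NC sum_distrib_left[symmetric])
  finally have "\<mu> = cnj \<mu>" using N by simp
  then have \<mu>r: "of_real (Re \<mu>) = \<mu>" by (simp add: complex_eq_iff)
  define v where "v x = w $ x / of_real (sqrt N)" for x
  have sq: "complex_of_real (sqrt N) * of_real (sqrt N) = of_real N"
    using N by (simp flip: of_real_mult)
  have "v x * cnj (v x) = w $ x * cnj (w $ x) / of_real N" for x
    by (simp add: v_def sq)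
  then have vv: "(\<Sum>x<n. v x * cnj (v x)) = 1"
    using N NC by (simp flip: sum_divide_distrib)
  have ve: "(\<Sum>x<n. v x * cnj (e i x)) = 0" if "i < k" for i
  proof -
    have "(\<Sum>x<n. v x * cnj (e i x)) = (\<Sum>x<n. w $ x * cnj (e i x)) / of_real (sqrt N)"
      unfolding sum_divide_distrib by (rule sum.cong[OF refl]) (simp add: v_def)
    then show ?thesis using ow[OF that] by simp
  qed
  then have ev: "(\<Sum>x<n. e i x * cnj (v x)) = 0" if "i < k" for i
    using arg_cong[OF ve[OF that], of cnj] by (simp add: cnj_sum mult.commute)
  have Av: "(\<Sum>y<n. A $$ (x, y) * v y) = of_real (Re \<mu>) * v x" if "x < n" for x
  proof -
    have "(\<Sum>y<n. A $$ (x, y) * v y) = (\<Sum>y<n. A $$ (x, y) * w $ y) / of_real (sqrt N)"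
      unfolding sum_divide_distrib by (rule sum.cong[OF refl]) (simp add: v_def)
    then show ?thesis using Aw[OF that] by (simp add: v_def \<mu>r)
  qed
  have "partial_eigenbasis n A (Suc k) (e(k := v)) (lam(k := Re \<mu>))"
    unfolding partial_eigenbasis_def
  proof (intro conjI allI impI)
    fix i j assume "i < Suc k" "j < Suc k"
    then consider "i = k" "j = k" | "i = k" "j < k" | "i < k" "j = k" | "i < k" "j < k" by linarith
    then show "(\<Sum>x<n. (e(k := v)) i x * cnj ((e(k := v)) j x)) = (if i = j then 1 else 0)"
      by cases (auto simp: vv ve ev orth)
  next
    fix i x assume "i < Suc k" "x < n"
    then consider "i = k" | "i < k" by linarith
    then show "(\<Sum>y<n. A $$ (x, y) * (e(k := v)) i y) = of_real ((lam(k := Re \<mu>)) i) * (e(k := v)) i x"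
      by cases (use Av eig \<open>x < n\<close> in auto)
  qed
  then show ?thesis by blast
qed

text \<open>Once \<open>n\<close> orthonormal eigenvectors have been collected, completeness follows
  because a one-sided inverse of a square matrix is two-sided.\<close>

theorem hermitian_eigensystem:
  assumes H: "hermitian_mat n A"
  shows "\<exists>e lam. eigensystem n A e lam"
proof -
  note A = hermitian_matD(1)[OF H]
  have "\<exists>e lam. partial_eigenbasis n A k e lam" if "k \<le> n" for k
    using that
  proof (induction k)
    case 0
    show ?case by (simp add: partial_eigenbasis_def)
  next
    case (Suc k)
    then obtain e lam where *: "partial_eigenbasis n A k e lam" using Suc_leD by blast
    have "k < n" using Suc.prems by simp
    from partial_eigenbasis_extend[OF H * this] show ?case by blast
  qed
  from this[of n] obtain e lam where pe: "partial_eigenbasis n A n e lam" by blast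
  have orth: "(\<Sum>x<n. e i x * cnj (e j x)) = (if i = j then 1 else 0)" if "i < n" "j < n" for i j
    using pe that unfolding partial_eigenbasis_def by blast
  have eig: "(\<Sum>y<n. A $$ (x, y) * e i y) = of_real (lam i) * e i x" if "i < n" "x < n" for i x
    using pe that unfolding partial_eigenbasis_def by blast
  define E where "E = mat n n (\<lambda>(i, x). e i x)"
  define F where "F = mat n n (\<lambda>(x, j). cnj (e j x))"
  have E: "E \<in> carrier_mat n n" and F: "F \<in> carrier_mat n n" by (simp_all add: E_def F_def)
  have "E * F = 1\<^sub>m n"
  proof (rule eq_matI)
    fix i j assume ij: "i < dim_row (1\<^sub>m n :: complex mat)" "j < dim_col (1\<^sub>m n :: complex mat)"
    have "(E * F) $$ (i, j) = (\<Sum>x<n. E $$ (i, x) * F $$ (x, j))"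
      using ij by (intro mat_mult_index[OF E F]) auto
    also have "\<dots> = (\<Sum>x<n. e i x * cnj (e j x))" using ij by (simp add: E_def F_def)
    finally show "(E * F) $$ (i, j) = 1\<^sub>m n $$ (i, j)" using ij by (simp add: orth)
  qed (use E F in auto)
  then have FE: "F * E = 1\<^sub>m n" by (rule mat_mult_left_right_inverse[OF E F])
  have compl: "(\<Sum>i<n. e i x * cnj (e i y)) = (if x = y then 1 else 0)" if "x < n" "y < n" for x y
  proof -
    have "(F * E) $$ (y, x) = (\<Sum>i<n. F $$ (y, i) * E $$ (i, x))"
      by (rule mat_mult_index[OF F E that(2,1)])
    also have "\<dots> = (\<Sum>i<n. e i x * cnj (e i y))" using that by (simp add: E_def F_def mult.commute)
    finally show ?thesis using that by (auto simp: FE)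
  qed
  \<comment> \<open>Expand the \<open>y\<close>-th unit vector in the eigenbasis and apply
    \<open>A\<close> to each term.\<close>
  have idx: "A $$ (x, y) = (\<Sum>i<n. of_real (lam i) * (e i x * cnj (e i y)))" if "x < n" "y < n" for x y
  proof -
    have "A $$ (x, y) = (\<Sum>z<n. if z = y then A $$ (x, z) else 0)" using that by simp
    also have "\<dots> = (\<Sum>z<n. A $$ (x, z) * (\<Sum>i<n. e i z * cnj (e i y)))"
      by (rule sum.cong[OF refl]) (use that in \<open>simp add: compl\<close>)
    also have "\<dots> = (\<Sum>i<n. \<Sum>z<n. A $$ (x, z) * e i z * cnj (e i y))"
      unfolding sum_distrib_left by (subst sum.swap) (simp add: mult_ac)
    also have "\<dots> = (\<Sum>i<n. (\<Sum>z<n. A $$ (x, z) * e i z) * cnj (e i y))"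
      by (simp only: sum_distrib_right)
    also have "\<dots> = (\<Sum>i<n. of_real (lam i) * (e i x * cnj (e i y)))"
      by (rule sum.cong[OF refl]) (use that in \<open>simp only: eig mult.assoc lessThan_iff\<close>)
    finally show ?thesis .
  qed
  have "eigensystem n A e lam"
    unfolding eigensystem_def by (intro conjI allI impI A orth compl idx)
  then show ?thesis by blast
qed

section \<open>Functional calculus in an eigenbasis and the two entropies\<close>

lemma eigensystemD:
  assumes "eigensystem n A e lam"
  shows eigensystem_carrier: "A \<in> carrier_mat n n"
    and eigensystem_orth: "\<And>i j. i < n \<Longrightarrow> j < n \<Longrightarrow> (\<Sum>x<n. e i x * cnj (e j x)) = (if i = j then 1 else 0)"
    and eigensystem_complete: "\<And>x y. x < n \<Longrightarrow> y < n \<Longrightarrow> (\<Sum>i<n. e i x * cnj (e i y)) = (if x = y then 1 else 0)"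
    and eigensystem_index: "\<And>x y. x < n \<Longrightarrow> y < n \<Longrightarrow>
      A $$ (x, y) = (\<Sum>i<n. of_real (lam i) * (e i x * cnj (e i y)))"
  using assms unfolding eigensystem_def by simp_all

text \<open>The matrices diagonal in the basis \<open>e\<close>. The operator itself, its
  eigenprojectors and its functions all have this form, so products and traces reduce to pointwise
  products and sums of \<open>g\<close>.\<close>

definition spectral_mat :: "nat \<Rightarrow> (nat \<Rightarrow> nat \<Rightarrow> complex) \<Rightarrow> (nat \<Rightarrow> complex) \<Rightarrow> complex mat" where
  "spectral_mat n e g = mat n n (\<lambda>(x, y). \<Sum>i<n. g i * (e i x * cnj (e i y)))"

lemma spectral_mat_carrier [simp]: "spectral_mat n e g \<in> carrier_mat n n"
  by (simp add: spectral_mat_def)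

lemma dim_spectral_mat [simp]:
  "dim_row (spectral_mat n e g) = n" "dim_col (spectral_mat n e g) = n"
  by (simp_all add: spectral_mat_def)

lemma spectral_mat_index [simp]:
  "x < n \<Longrightarrow> y < n \<Longrightarrow> spectral_mat n e g $$ (x, y) = (\<Sum>i<n. g i * (e i x * cnj (e i y)))"
  by (simp add: spectral_mat_def)

lemma eigensystem_spectral_mat:
  "eigensystem n A e lam \<Longrightarrow> A = spectral_mat n e (\<lambda>i. of_real (lam i))"
  by (intro eq_matI) (auto simp: eigensystem_index dest: eigensystem_carrier)

lemma spectral_mat_one:
  "eigensystem n A e lam \<Longrightarrow> spectral_mat n e (\<lambda>i. 1) = 1\<^sub>m n"
  by (intro eq_matI) (auto simp: eigensystem_complete)

lemma spectral_mat_mult: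
  assumes es: "eigensystem n A e lam"
  shows "spectral_mat n e g * spectral_mat n e h = spectral_mat n e (\<lambda>i. g i * h i)"
proof (rule eq_matI)
  fix x y assume "x < dim_row (spectral_mat n e (\<lambda>i. g i * h i))" "y < dim_col (spectral_mat n e (\<lambda>i. g i * h i))"
  then have xy: "x < n" "y < n" by auto
  have "(spectral_mat n e g * spectral_mat n e h) $$ (x, y)
      = (\<Sum>z<n. spectral_mat n e g $$ (x, z) * spectral_mat n e h $$ (z, y))"
    by (rule mat_mult_index) (use xy in auto)
  also have "\<dots> = (\<Sum>z<n. \<Sum>i<n. \<Sum>j<n. (g i * (e i x * cnj (e i z))) * (h j * (e j z * cnj (e j y))))"
    using xy by (simp add: sum_product)
  also have "\<dots> = (\<Sum>z<n. \<Sum>i<n. \<Sum>j<n. g i * h j * e i x * cnj (e j y) * (e j z * cnj (e i z)))"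
    by (intro sum.cong refl) (simp only: mult_ac)
  also have "\<dots> = (\<Sum>i<n. \<Sum>j<n. \<Sum>z<n. g i * h j * e i x * cnj (e j y) * (e j z * cnj (e i z)))"
    by (subst sum.swap, rule sum.cong[OF refl], rule sum.swap)
  also have "\<dots> = (\<Sum>i<n. \<Sum>j<n. if j = i then g i * h i * (e i x * cnj (e i y)) else 0)"
    by (intro sum.cong refl, subst sum_distrib_left[symmetric])
       (auto simp: eigensystem_orth[OF es] mult.assoc)
  also have "\<dots> = spectral_mat n e (\<lambda>i. g i * h i) $$ (x, y)"
    using xy by simp
  finally show "(spectral_mat n e g * spectral_mat n e h) $$ (x, y) = \<dots>" .
qed auto

lemma spectral_mat_trace:
  assumes es: "eigensystem n A e lam"
  shows "mat_trace (spectral_mat n e g) = (\<Sum>i<n. g i)"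
proof -
  have "mat_trace (spectral_mat n e g) = (\<Sum>i<n. g i * (\<Sum>x<n. e i x * cnj (e i x)))"
    by (simp add: mat_trace_def) (subst sum.swap, simp add: sum_distrib_left)
  then show ?thesis by (simp add: eigensystem_orth[OF es])
qed

lemma spectral_mat_hermitian:
  "(\<And>i. i < n \<Longrightarrow> cnj (g i) = g i) \<Longrightarrow> hermitian_mat n (spectral_mat n e g)"
  by (rule hermitian_matI) (auto simp: cnj_sum mult_ac)

text \<open>Applying the matrix multiplies the \<open>i\<close>-th coefficient by
  \<open>g i\<close>. Orthonormality reads off the coefficients, and completeness rebuilds the
  vector from them.\<close>

lemma spectral_mat_vec_eq_iff:
  assumes es: "eigensystem n A e lam" and v: "v \<in> carrier_vec n" and w: "w \<in> carrier_vec n"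
  shows "spectral_mat n e g *\<^sub>v v = w \<longleftrightarrow>
    (\<forall>i<n. g i * (\<Sum>x<n. v $ x * cnj (e i x)) = (\<Sum>x<n. w $ x * cnj (e i x)))"
proof -
  have Gv: "(spectral_mat n e g *\<^sub>v v) $ x = (\<Sum>j<n. g j * (\<Sum>y<n. v $ y * cnj (e j y)) * e j x)"
    if "x < n" for x
  proof -
    have "(spectral_mat n e g *\<^sub>v v) $ x = (\<Sum>y<n. \<Sum>j<n. g j * (v $ y * cnj (e j y)) * e j x)"
      using that by (simp add: mat_vec_index[OF spectral_mat_carrier v] sum_distrib_left mult_ac
          del: index_mult_mat_vec)
    then show ?thesis by (subst (asm) sum.swap) (simp only: sum_distrib_left sum_distrib_right)
  qed
  have coef: "(\<Sum>x<n. (\<Sum>j<n. b j * e j x) * cnj (e i x)) = b i" if "i < n" for b i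
  proof -
    have "(\<Sum>x<n. (\<Sum>j<n. b j * e j x) * cnj (e i x)) = (\<Sum>j<n. b j * (\<Sum>x<n. e j x * cnj (e i x)))"
      unfolding sum_distrib_left sum_distrib_right by (subst sum.swap) (simp only: mult_ac)
    also have "\<dots> = (\<Sum>j<n. if j = i then b i else 0)"
      by (rule sum.cong[OF refl]) (use that in \<open>auto simp: eigensystem_orth[OF es]\<close>)
    finally show ?thesis using that by simp
  qed
  have expand: "w $ x = (\<Sum>j<n. (\<Sum>y<n. w $ y * cnj (e j y)) * e j x)" if "x < n" for x
  proof -
    have "(\<Sum>j<n. (\<Sum>y<n. w $ y * cnj (e j y)) * e j x) = (\<Sum>y<n. w $ y * (\<Sum>j<n. e j x * cnj (e j y)))"
      unfolding sum_distrib_left sum_distrib_right by (subst sum.swap) (simp only: mult_ac)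
    also have "\<dots> = (\<Sum>y<n. if y = x then w $ x else 0)"
      by (rule sum.cong[OF refl]) (use that in \<open>auto simp: eigensystem_complete[OF es]\<close>)
    finally show ?thesis using that by simp
  qed
  show ?thesis
  proof
    assume "spectral_mat n e g *\<^sub>v v = w"
    then have "w $ x = (\<Sum>j<n. (g j * (\<Sum>y<n. v $ y * cnj (e j y))) * e j x)" if "x < n" for x
      using Gv[OF that] by simp
    then show "\<forall>i<n. g i * (\<Sum>x<n. v $ x * cnj (e i x)) = (\<Sum>x<n. w $ x * cnj (e i x))"
      by (simp add: coef)
  next
    assume eq: "\<forall>i<n. g i * (\<Sum>x<n. v $ x * cnj (e i x)) = (\<Sum>x<n. w $ x * cnj (e i x))"
    show "spectral_mat n e g *\<^sub>v v = w"
    proof (rule eq_vecI)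
      fix x assume "x < dim_vec w"
      then have x: "x < n" using w by simp
      have "(spectral_mat n e g *\<^sub>v v) $ x = (\<Sum>j<n. (\<Sum>y<n. w $ y * cnj (e j y)) * e j x)"
        unfolding Gv[OF x] by (rule sum.cong[OF refl]) (use eq in simp)
      then show "(spectral_mat n e g *\<^sub>v v) $ x = w $ x" using expand[OF x] by simp
    qed (use w in simp)
  qed
qed

text \<open>In coefficients the eigenvalue equation says that \<open>lam i - \<mu>\<close>
  annihilates the \<open>i\<close>-th one.\<close>

lemma eigenvector_iff_coefficients:
  assumes es: "eigensystem n A e lam" and v: "v \<in> carrier_vec n"
  shows "A *\<^sub>v v = \<mu> \<cdot>\<^sub>v v \<longleftrightarrow>
    (\<forall>i<n. of_real (lam i) \<noteq> \<mu> \<longrightarrow> (\<Sum>x<n. v $ x * cnj (e i x)) = 0)"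
proof -
  have "(\<Sum>x<n. (\<mu> \<cdot>\<^sub>v v) $ x * cnj (e i x)) = \<mu> * (\<Sum>x<n. v $ x * cnj (e i x))" for i
    using v by (simp add: sum_distrib_left mult_ac)
  then show ?thesis
    unfolding eigensystem_spectral_mat[OF es]
    using v by (subst spectral_mat_vec_eq_iff[OF es]) auto
qed

lemma eigensystem_spectrum:
  assumes es: "eigensystem n A e lam"
  shows "spectrum A = (\<lambda>i. complex_of_real (lam i)) ` {..<n}"
proof (intro equalityI subsetI)
  note A = eigensystem_carrier[OF es]
  fix \<mu> assume "\<mu> \<in> spectrum A"
  then obtain v where v: "v \<in> carrier_vec n" "v \<noteq> 0\<^sub>v n" "A *\<^sub>v v = \<mu> \<cdot>\<^sub>v v"
    using A unfolding spectrum_def eigenvalue_def eigenvector_def by auto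
  show "\<mu> \<in> (\<lambda>i. complex_of_real (lam i)) ` {..<n}"
  proof (rule ccontr)
    assume "\<not> ?thesis"
    then have "\<forall>i<n. (\<Sum>x<n. v $ x * cnj (e i x)) = 0"
      using v eigenvector_iff_coefficients[OF es v(1), of \<mu>] by force
    then have "spectral_mat n e (\<lambda>i. 1) *\<^sub>v v = 0\<^sub>v n"
      using v by (subst spectral_mat_vec_eq_iff[OF es]) auto
    then show False using v by (simp add: spectral_mat_one[OF es])
  qed
next
  note A = eigensystem_carrier[OF es]
  fix \<mu> assume "\<mu> \<in> (\<lambda>i. complex_of_real (lam i)) ` {..<n}"
  then obtain i where i: "i < n" "\<mu> = of_real (lam i)" by auto
  define v where "v = vec n (e i)"
  have v: "v \<in> carrier_vec n" and vc: "(\<Sum>x<n. v $ x * cnj (e j x)) = (if i = j then 1 else 0)" if "j < n" for j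
    using that i by (simp_all add: v_def eigensystem_orth[OF es])
  have "A *\<^sub>v v = \<mu> \<cdot>\<^sub>v v"
    using v[OF i(1)] vc i by (subst eigenvector_iff_coefficients[OF es]) auto
  moreover have "v \<noteq> 0\<^sub>v n"
  proof
    assume "v = 0\<^sub>v n"
    then show False using vc[OF i(1)] by simp
  qed
  ultimately show "\<mu> \<in> spectrum A"
    using v[OF i(1)] A unfolding spectrum_def eigenvalue_def eigenvector_def by auto
qed

text \<open>The definite description calls for uniqueness. Two Hermitian idempotents with the same
  fixed vectors satisfy P * Q = Q and Q * P = P, and the adjoint of the first equation is Q * P = Q.
  For \<open>\<mu>\<close> outside the spectrum the result is the zero matrix.\<close>

lemma eigensystem_eigenprojector:
  assumes es: "eigensystem n A e lam"
  shows "eigenprojector A \<mu> = spectral_mat n e (\<lambda>i. if of_real (lam i) = \<mu> then 1 else 0)"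
    (is "_ = ?P")
proof -
  have dim: "dim_row A = n" using eigensystem_carrier[OF es] by simp
  have P1: "hermitian_mat n ?P" by (rule spectral_mat_hermitian) auto
  have P2: "?P * ?P = ?P" unfolding spectral_mat_mult[OF es] by (rule arg_cong[where f = "spectral_mat n e"]) auto
  have P3: "?P *\<^sub>v v = v \<longleftrightarrow> A *\<^sub>v v = \<mu> \<cdot>\<^sub>v v" if "v \<in> carrier_vec n" for v
    unfolding spectral_mat_vec_eq_iff[OF es that that] eigenvector_iff_coefficients[OF es that] by auto
  \<comment> \<open>Every column of the idempotent \<open>S\<close> is fixed by \<open>S\<close>,
    hence by \<open>R\<close>.\<close>
  have absorb: "R * S = S"
    if R: "hermitian_mat n R" and S: "hermitian_mat n S" "S * S = S"
      and fp: "\<And>v. v \<in> carrier_vec n \<Longrightarrow> S *\<^sub>v v = v \<Longrightarrow> R *\<^sub>v v = v" for R S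
  proof (rule mat_col_eqI)
    note Rc = hermitian_matD(1)[OF R] and Sc = hermitian_matD(1)[OF S(1)]
    fix i assume "i < dim_col S"
    then have i: "i < n" using Sc by simp
    have "S *\<^sub>v col S i = col S i"
      using col_mult2[OF Sc Sc i] S(2) by simp
    moreover have "col S i \<in> carrier_vec n" using Sc by (intro carrier_vecI) simp
    ultimately have "R *\<^sub>v col S i = col S i" using fp by blast
    then show "col (R * S) i = col S i" using col_mult2[OF Rc Sc i] by simp
  qed (use hermitian_matD(1)[OF R] hermitian_matD(1)[OF S(1)] in auto)
  have uniq: "Q = ?P" if Q: "hermitian_mat n Q" "Q * Q = Q"
    "\<forall>v\<in>carrier_vec n. Q *\<^sub>v v = v \<longleftrightarrow> A *\<^sub>v v = \<mu> \<cdot>\<^sub>v v" for Q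
  proof -
    note Qc = hermitian_matD(1)[OF Q(1)]
    have PQ: "?P * Q = Q" and QP: "Q * ?P = ?P"
      using absorb[OF P1 Q(1,2)] absorb[OF Q(1) P1 P2] Q(3) P3 by auto
    have "Q $$ (x, y) = ?P $$ (x, y)" if xy: "x < n" "y < n" for x y
    proof -
      have "Q $$ (x, y) = cnj (Q $$ (y, x))" using hermitian_matD(2)[OF Q(1)] xy by simp
      also have "Q $$ (y, x) = (\<Sum>z<n. ?P $$ (y, z) * Q $$ (z, x))"
        using mat_mult_index[OF spectral_mat_carrier Qc xy(2,1)] PQ by metis
      also have "cnj \<dots> = (\<Sum>z<n. Q $$ (x, z) * ?P $$ (z, y))"
        unfolding cnj_sum complex_cnj_mult using xy
        by (intro sum.cong refl)
           (simp only: hermitian_matD(2)[OF Q(1)] hermitian_matD(2)[OF P1] lessThan_iff mult.commute)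
      also have "\<dots> = ?P $$ (x, y)"
        using mat_mult_index[OF Qc spectral_mat_carrier xy] QP by metis
      finally show ?thesis .
    qed
    then show ?thesis using Qc by (intro eq_matI) auto
  qed
  show ?thesis
    unfolding eigenprojector_def dim
  proof (rule the_equality)
    show "hermitian_mat n ?P \<and> ?P * ?P = ?P \<and> (\<forall>v\<in>carrier_vec n. ?P *\<^sub>v v = v \<longleftrightarrow> A *\<^sub>v v = \<mu> \<cdot>\<^sub>v v)"
      by (intro conjI ballI P1 P2 P3)
  next
    fix Q assume Q: "hermitian_mat n Q \<and> Q * Q = Q \<and> (\<forall>v\<in>carrier_vec n. Q *\<^sub>v v = v \<longleftrightarrow> A *\<^sub>v v = \<mu> \<cdot>\<^sub>v v)"
    show "Q = ?P"
      by (rule uniq[OF conjunct1[OF Q] conjunct1[OF conjunct2[OF Q]] conjunct2[OF conjunct2[OF Q]]])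
  qed
qed

text \<open>The definition sums over distinct eigenvalues; after exchanging the sums, each index
  \<open>i\<close> is selected by exactly one of them.\<close>

lemma eigensystem_hermitian_fun:
  assumes es: "eigensystem n A e lam"
  shows "hermitian_fun f A = spectral_mat n e (\<lambda>i. of_real (f (lam i)))"
proof (rule eq_matI)
  fix x y assume "x < dim_row (spectral_mat n e (\<lambda>i. of_real (f (lam i))))"
    "y < dim_col (spectral_mat n e (\<lambda>i. of_real (f (lam i))))"
  then have xy: "x < n" "y < n" by auto
  have fin: "finite (spectrum A)" by (simp add: eigensystem_spectrum[OF es])
  have "hermitian_fun f A $$ (x, y) = (\<Sum>\<mu>\<in>spectrum A. \<Sum>i<n.
      of_real (f (Re \<mu>)) * ((if of_real (lam i) = \<mu> then 1 else 0) * (e i x * cnj (e i y))))"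
    using xy eigensystem_carrier[OF es]
    by (simp add: hermitian_fun_def eigensystem_eigenprojector[OF es] sum_distrib_left)
  also have "\<dots> = (\<Sum>i<n. \<Sum>\<mu>\<in>spectrum A.
      if \<mu> = of_real (lam i) then of_real (f (lam i)) * (e i x * cnj (e i y)) else 0)"
    by (subst sum.swap, intro sum.cong refl) auto
  also have "\<dots> = (\<Sum>i<n. of_real (f (lam i)) * (e i x * cnj (e i y)))"
    by (rule sum.cong[OF refl]) (auto simp: fin, simp add: eigensystem_spectrum[OF es])
  finally show "hermitian_fun f A $$ (x, y) = spectral_mat n e (\<lambda>i. of_real (f (lam i))) $$ (x, y)"
    using xy by simp
qed (use eigensystem_carrier[OF es] in \<open>auto simp: hermitian_fun_def\<close>)

lemma eigensystem_vn_entropy: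
  assumes es: "eigensystem n A e lam"
  shows "vn_entropy A = - (\<Sum>i<n. lam i * log 2 (lam i))"
proof -
  have "A * hermitian_fun (log 2) A = spectral_mat n e (\<lambda>i. of_real (lam i) * of_real (log 2 (lam i)))"
    unfolding eigensystem_hermitian_fun[OF es]
    using spectral_mat_mult[OF es, of "\<lambda>i. of_real (lam i)"] eigensystem_spectral_mat[OF es] by metis
  then show ?thesis by (simp add: vn_entropy_def spectral_mat_trace[OF es])
qed

text \<open>Subadditivity of the rank is used twice: it bounds the rank above, as the matrix is a
  sum of \<open>card I\<close> matrices of rank at most one, and below, as the projector for the
  complement has rank at most \<open>n - card I\<close> and both together give the identity of rank
  \<open>n\<close>.\<close>

lemma rank_spectral_mat_indicator:
  assumes es: "eigensystem n A e lam" and I: "I \<subseteq> {..<n}"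
  shows "vec_space.rank n (spectral_mat n e (\<lambda>i. if i \<in> I then 1 else 0)) = card I"
proof -
  interpret vec_space "TYPE(complex)" n .
  let ?F = "\<lambda>I. spectral_mat n e (\<lambda>i. if i \<in> I then 1 else 0)"
  have add: "?F (I \<union> J) = ?F I + ?F J" if "I \<inter> J = {}" for I J
    by (rule eq_matI)
       (use that in \<open>auto simp: sum.distrib[symmetric] distrib_right[symmetric] intro!: sum.cong\<close>)
  have one: "rank (?F {i}) \<le> 1" if "i < n" for i
  proof (rule rank_le_1_product_entries[OF spectral_mat_carrier])
    fix r c assume "r < dim_row (?F {i})" "c < dim_col (?F {i})"
    then have rc: "r < n" "c < n" by auto
    have "?F {i} $$ (r, c) = (\<Sum>j<n. if j = i then e i r * cnj (e i c) else 0)"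
      unfolding spectral_mat_index[OF rc] by (rule sum.cong[OF refl]) auto
    then show "?F {i} $$ (r, c) = e i r * cnj (e i c)" using that by simp
  qed
  have le: "rank (?F I) \<le> card I" if "finite I" "I \<subseteq> {..<n}" for I
    using that
  proof (induction I)
    case empty
    have "?F {} = 0\<^sub>m n n" by (rule eq_matI) simp_all
    then show ?case by (simp only: rank_0I card.empty order_refl)
  next
    case (insert i I)
    have "?F (insert i I) = ?F {i} + ?F I" using add[of "{i}" I] insert by simp
    then have "rank (?F (insert i I)) \<le> rank (?F {i}) + rank (?F I)"
      by (simp only: rank_subadditive[OF spectral_mat_carrier spectral_mat_carrier])
    moreover have "rank (?F I) \<le> card I" "rank (?F {i}) \<le> 1" using insert one[of i] by blast+
    ultimately show ?case unfolding card_insert_disjoint[OF insert.hyps] by linarith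
  qed
  have fin: "finite I" using I finite_subset by blast
  have "?F {..<n} = 1\<^sub>m n" unfolding spectral_mat_one[OF es, symmetric] by (rule eq_matI) simp_all
  moreover have "I \<union> ({..<n} - I) = {..<n}" using I by blast
  ultimately have "1\<^sub>m n = ?F I + ?F ({..<n} - I)" using add[of I "{..<n} - I"] by (simp only: Diff_disjoint)
  then have "rank (1\<^sub>m n :: complex mat) \<le> rank (?F I) + rank (?F ({..<n} - I))"
    by (simp only: rank_subadditive[OF spectral_mat_carrier spectral_mat_carrier])
  moreover have "rank (1\<^sub>m n :: complex mat) = n" using det_rank_iff[of "1\<^sub>m n"] by simp
  moreover have "rank (?F ({..<n} - I)) \<le> n - card I"
    using le[of "{..<n} - I"] fin I by (simp add: card_Diff_subset)
  moreover have "card I \<le> n" using card_mono[OF _ I] by simp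
  ultimately show ?thesis using le[OF fin I] by linarith
qed

text \<open>The outer factor \<open>r\<close> of the definition counts the indices that share an
  eigenvalue, so it is absorbed by summing over the eigenbasis. The inner \<open>r\<close> remains
  as the size of the block containing \<open>i\<close>, the form in which the entropy bound produces
  it.\<close>

lemma eigensystem_catalytic_entropy:
  assumes es: "eigensystem n A e lam"
  shows "catalytic_entropy A = - (\<Sum>i<n. lam i * log 2 (lam i / real (card {j\<in>{..<n}. lam j = lam i})))"
proof -
  let ?r = "\<lambda>\<mu>. real (card {j\<in>{..<n}. complex_of_real (lam j) = \<mu>})"
  have rank: "real (vec_space.rank (dim_row A) (eigenprojector A \<mu>)) = ?r \<mu>" for \<mu>
  proof -
    have "eigenprojector A \<mu> = spectral_mat n e (\<lambda>i. if i \<in> {j\<in>{..<n}. of_real (lam j) = \<mu>} then 1 else 0)"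
      unfolding eigensystem_eigenprojector[OF es] by (rule eq_matI) auto
    then show ?thesis
      using rank_spectral_mat_indicator[OF es, of "{j\<in>{..<n}. of_real (lam j) = \<mu>}"] eigensystem_carrier[OF es]
      by auto
  qed
  have "(\<Sum>i<n. lam i * log 2 (lam i / ?r (of_real (lam i))))
      = (\<Sum>\<mu>\<in>(\<lambda>i. complex_of_real (lam i)) ` {..<n}. \<Sum>i\<in>{i\<in>{..<n}. complex_of_real (lam i) = \<mu>}.
          lam i * log 2 (lam i / ?r (of_real (lam i))))"
    by (rule sum.image_gen) simp
  also have "\<dots> = (\<Sum>\<mu>\<in>spectrum A. ?r \<mu> * (Re \<mu> * log 2 (Re \<mu> / ?r \<mu>)))"
    unfolding eigensystem_spectrum[OF es]
  proof (rule sum.cong[OF refl])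
    fix \<mu> :: complex
    have "(\<Sum>i\<in>{i\<in>{..<n}. complex_of_real (lam i) = \<mu>}. lam i * log 2 (lam i / ?r (of_real (lam i))))
        = (\<Sum>i\<in>{i\<in>{..<n}. complex_of_real (lam i) = \<mu>}. Re \<mu> * log 2 (Re \<mu> / ?r \<mu>))"
      by (rule sum.cong[OF refl]) auto
    then show "(\<Sum>i\<in>{i\<in>{..<n}. complex_of_real (lam i) = \<mu>}. lam i * log 2 (lam i / ?r (of_real (lam i))))
        = ?r \<mu> * (Re \<mu> * log 2 (Re \<mu> / ?r \<mu>))"
      by simp
  qed
  finally show ?thesis unfolding catalytic_entropy_def Let_def rank by (simp add: mult_ac)
qed

lemma eigensystem_nonneg:
  assumes es: "eigensystem n A e lam" and psd: "psd_mat n A" and i: "i < n"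
  shows "0 \<le> lam i"
proof -
  define v where "v = vec n (e i)"
  have v: "v \<in> carrier_vec n" by (simp add: v_def)
  have vc: "(\<Sum>x<n. v $ x * cnj (e j x)) = (if i = j then 1 else 0)" if "j < n" for j
    using that i by (simp add: v_def eigensystem_orth[OF es])
  have "A *\<^sub>v v = of_real (lam i) \<cdot>\<^sub>v v"
    using v vc i by (subst eigenvector_iff_coefficients[OF es]) auto
  moreover have "v \<bullet>c v = 1"
    using vc[OF i] by (simp add: scalar_prod_def lessThan_atLeast0 v_def)
  ultimately have "(A *\<^sub>v v) \<bullet>c v = of_real (lam i)" using v by simp
  moreover have "0 \<le> Re ((A *\<^sub>v v) \<bullet>c v)" using psd v by (simp add: psd_mat_def)
  ultimately show ?thesis by simp
qed

lemma quantum_state_eigensystem: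
  assumes "quantum_state n \<rho>"
  obtains e lam where "eigensystem n \<rho> e lam" "\<And>i. i < n \<Longrightarrow> 0 \<le> lam i" "(\<Sum>i<n. lam i) = 1"
proof -
  have psd: "psd_mat n \<rho>" and tr: "mat_trace \<rho> = 1" using assms by (auto simp: quantum_state_def)
  then obtain e lam where es: "eigensystem n \<rho> e lam"
    using hermitian_eigensystem psd_mat_def by blast
  have "complex_of_real (\<Sum>i<n. lam i) = mat_trace \<rho>"
    using spectral_mat_trace[OF es, of "\<lambda>i. of_real (lam i)"] eigensystem_spectral_mat[OF es] by simp
  then have "(\<Sum>i<n. lam i) = 1" using tr by (metis of_real_1 of_real_eq_iff)
  then show ?thesis using that es eigensystem_nonneg[OF es psd] by blast
qed

subsection \<open>Composite systems\<close>

lemma sum_pair_index: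
  "(\<Sum>r<m * n. g r) = (\<Sum>i<m. \<Sum>k<n. g (i * n + k))" for m n :: nat
proof -
  have "sum g {i * n..<i * n + n} = (\<Sum>k<n. g (i * n + k))" for i
    using sum.shift_bounds_nat_ivl[of g 0 "i * n" n] by (simp add: lessThan_atLeast0 add.commute)
  then show ?thesis using sum.nat_group[of g n m] by simp
qed

lemma pair_index_less:
  fixes i k m n :: nat
  assumes "i < m" "k < n"
  shows "i * n + k < m * n"
proof -
  have "i * n + k < Suc i * n" using assms by simp
  also have "\<dots> \<le> m * n" using assms by (intro mult_le_mono1) simp
  finally show ?thesis .
qed

lemma pair_index_eq_iff:
  fixes i j k l n :: nat
  assumes "k < n" "l < n"
  shows "i * n + k = j * n + l \<longleftrightarrow> i = j \<and> k = l"
proof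
  assume eq: "i * n + k = j * n + l"
  have "(i * n + k) div n = i" "(j * n + l) div n = j" using assms by simp_all
  then have "i = j" using eq by simp
  then show "i = j \<and> k = l" using eq by simp
qed simp

lemma pair_index_cases:
  fixes r m n :: nat
  assumes "r < m * n"
  obtains i k where "i < m" "k < n" "r = i * n + k"
proof
  have "0 < n" using assms by (cases n) auto
  then show "r mod n < n" by simp
  show "r div n < m" using assms by (simp add: less_mult_imp_div_less)
  show "r = r div n * n + r mod n" by simp
qed

lemma kron_carrier [simp]:
  "A \<in> carrier_mat m m' \<Longrightarrow> B \<in> carrier_mat n n' \<Longrightarrow> kron A B \<in> carrier_mat (m * n) (m' * n')"
  by (auto simp: kron_def)

lemma kron_index:
  assumes "A \<in> carrier_mat m m'" "B \<in> carrier_mat n n'" "i < m" "j < m'" "k < n" "l < n'"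
  shows "kron A B $$ (i * n + k, j * n' + l) = A $$ (i, j) * B $$ (k, l)"
  using assms pair_index_less[of i m k n] pair_index_less[of j m' l n'] by (auto simp: kron_def)

lemma tensor_eqI:
  assumes "A \<in> carrier_mat (m * n) (m' * n')" "B \<in> carrier_mat (m * n) (m' * n')"
    and "\<And>i k j l. i < m \<Longrightarrow> k < n \<Longrightarrow> j < m' \<Longrightarrow> l < n' \<Longrightarrow>
      A $$ (i * n + k, j * n' + l) = B $$ (i * n + k, j * n' + l)"
  shows "A = B"
proof (rule eq_matI)
  fix r c assume "r < dim_row B" "c < dim_col B"
  then have "r < m * n" "c < m' * n'" using assms(2) by auto
  then show "A $$ (r, c) = B $$ (r, c)" by (metis pair_index_cases assms(3))
qed (use assms in auto)

lemma kron_mult: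
  assumes A: "A \<in> carrier_mat m m" and C: "C \<in> carrier_mat m m"
    and B: "B \<in> carrier_mat n n" and D: "D \<in> carrier_mat n n"
  shows "kron A B * kron C D = kron (A * C) (B * D)"
proof (rule tensor_eqI[of _ m n m n])
  fix i k j l assume ix: "i < m" "k < n" "j < m" "l < n"
  have "(kron A B * kron C D) $$ (i * n + k, j * n + l)
      = (\<Sum>r<m * n. kron A B $$ (i * n + k, r) * kron C D $$ (r, j * n + l))"
    using ix by (intro mat_mult_index[OF kron_carrier[OF A B] kron_carrier[OF C D]] pair_index_less)
  also have "\<dots> = (\<Sum>i'<m. \<Sum>k'<n. (A $$ (i, i') * C $$ (i', j)) * (B $$ (k, k') * D $$ (k', l)))"
    unfolding sum_pair_index
    by (intro sum.cong refl) (use ix in \<open>simp add: kron_index[OF A B] kron_index[OF C D]\<close>)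
  also have "\<dots> = (A * C) $$ (i, j) * (B * D) $$ (k, l)"
    unfolding mat_mult_index[OF A C ix(1,3)] mat_mult_index[OF B D ix(2,4)] sum_product ..
  also have "\<dots> = kron (A * C) (B * D) $$ (i * n + k, j * n + l)"
    using ix by (intro kron_index[symmetric, OF mult_carrier_mat[OF A C] mult_carrier_mat[OF B D]])
  finally show "(kron A B * kron C D) $$ (i * n + k, j * n + l) = \<dots>" .
next
  show "kron A B * kron C D \<in> carrier_mat (m * n) (m * n)"
    by (rule mult_carrier_mat[OF kron_carrier[OF A B] kron_carrier[OF C D]])
  show "kron (A * C) (B * D) \<in> carrier_mat (m * n) (m * n)"
    by (rule kron_carrier[OF mult_carrier_mat[OF A C] mult_carrier_mat[OF B D]])
qed

lemma kron_adjoint: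
  assumes A: "A \<in> carrier_mat m m" and B: "B \<in> carrier_mat n n"
  shows "mat_adjoint (kron A B) = kron (mat_adjoint A) (mat_adjoint B)"
proof (rule tensor_eqI[of _ m n m n])
  fix i k j l assume ix: "i < m" "k < n" "j < m" "l < n"
  note ixs = pair_index_less[OF ix(1,2)] pair_index_less[OF ix(3,4)]
  have "mat_adjoint (kron A B) $$ (i * n + k, j * n + l) = cnj (kron A B $$ (j * n + l, i * n + k))"
    using ixs kron_carrier[OF A B] by (intro mat_adjoint_index) auto
  then show "mat_adjoint (kron A B) $$ (i * n + k, j * n + l)
      = kron (mat_adjoint A) (mat_adjoint B) $$ (i * n + k, j * n + l)"
    using ix A B
    by (simp add: kron_index[OF A B] kron_index[OF mat_adjoint_carrier[OF A] mat_adjoint_carrier[OF B]])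
qed (use assms in auto)

lemma kron_one: "kron (1\<^sub>m m) (1\<^sub>m n) = 1\<^sub>m (m * n)"
proof (rule tensor_eqI[of _ m n m n])
  fix i k j l assume ix: "i < m" "k < n" "j < m" "l < n"
  note ixs = pair_index_less[OF ix(1,2)] pair_index_less[OF ix(3,4)]
  show "kron (1\<^sub>m m) (1\<^sub>m n) $$ (i * n + k, j * n + l) = 1\<^sub>m (m * n) $$ (i * n + k, j * n + l)"
    using ix ixs by (simp add: kron_index[OF one_carrier_mat one_carrier_mat] pair_index_eq_iff)
qed auto

section \<open>Unitaries and rotations of the second factor\<close>

lemma mat_adjoint_mult:
  fixes A B :: "complex mat"
  assumes A: "A \<in> carrier_mat n m" and B: "B \<in> carrier_mat m p"
  shows "mat_adjoint (A * B) = mat_adjoint B * mat_adjoint A"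
proof (rule eq_matI)
  fix i j assume "i < dim_row (mat_adjoint B * mat_adjoint A)" "j < dim_col (mat_adjoint B * mat_adjoint A)"
  then have ij: "i < p" "j < n" using A B by auto
  have "mat_adjoint (A * B) $$ (i, j) = cnj ((A * B) $$ (j, i))"
    using ij A B by (intro mat_adjoint_index) auto
  also have "\<dots> = (\<Sum>k<m. mat_adjoint B $$ (i, k) * mat_adjoint A $$ (k, j))"
    unfolding mat_mult_index[OF A B ij(2,1)] cnj_sum
    by (rule sum.cong[OF refl]) (use ij A B in simp)
  also have "\<dots> = (mat_adjoint B * mat_adjoint A) $$ (i, j)"
    by (rule mat_mult_index[symmetric, OF mat_adjoint_carrier[OF B] mat_adjoint_carrier[OF A] ij])
  finally show "mat_adjoint (A * B) $$ (i, j) = (mat_adjoint B * mat_adjoint A) $$ (i, j)" .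
qed (use A B in auto)

lemma mat_adjoint_adjoint [simp]: "mat_adjoint (mat_adjoint A) = A" for A :: "complex mat"
  by (rule eq_matI) auto

lemma mat_adjoint_one [simp]: "mat_adjoint (1\<^sub>m n) = (1\<^sub>m n :: complex mat)"
  by (rule eq_matI) auto

lemma unitary_matD:
  assumes "unitary_mat n U"
  shows "U \<in> carrier_mat n n" "mat_adjoint U * U = 1\<^sub>m n" "U * mat_adjoint U = 1\<^sub>m n"
  using assms unfolding unitary_mat_def by blast+

lemma unitary_adjoint: "unitary_mat n U \<Longrightarrow> unitary_mat n (mat_adjoint U)"
  by (auto simp: unitary_mat_def)

lemma unitary_mult:
  assumes "unitary_mat n U" "unitary_mat n V"
  shows "unitary_mat n (U * V)"
proof -
  note U = unitary_matD[OF assms(1)] and V = unitary_matD[OF assms(2)]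
  note aU = mat_adjoint_carrier[OF U(1)] and aV = mat_adjoint_carrier[OF V(1)]
  have "mat_adjoint V * mat_adjoint U * (U * V) = mat_adjoint V * ((mat_adjoint U * U) * V)"
    using U(1) V(1) aU aV by (simp add: assoc_mult_mat[of _ n n _ n _ n] mult_carrier_mat[of _ n n _ n])
  moreover have "U * V * (mat_adjoint V * mat_adjoint U) = U * ((V * mat_adjoint V) * mat_adjoint U)"
    using U(1) V(1) aU aV by (simp add: assoc_mult_mat[of _ n n _ n _ n] mult_carrier_mat[of _ n n _ n])
  ultimately show ?thesis
    unfolding unitary_mat_def mat_adjoint_mult[OF U(1) V(1)]
    using U V aU aV by simp
qed

lemma unitary_kron_one:
  assumes "unitary_mat n G"
  shows "unitary_mat (m * n) (kron (1\<^sub>m m) G)"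
proof -
  note G = unitary_matD[OF assms]
  show ?thesis
    unfolding unitary_mat_def kron_adjoint[OF one_carrier_mat G(1)]
    using G mat_adjoint_carrier[OF G(1)]
    by (simp add: kron_mult[OF one_carrier_mat one_carrier_mat mat_adjoint_carrier[OF G(1)] G(1)]
        kron_mult[OF one_carrier_mat one_carrier_mat G(1) mat_adjoint_carrier[OF G(1)]] kron_one)
qed

lemma unitary_mat_sums:
  assumes "unitary_mat n U"
  shows "\<And>i j. i < n \<Longrightarrow> j < n \<Longrightarrow> (\<Sum>x<n. cnj (U $$ (x, i)) * U $$ (x, j)) = (if i = j then 1 else 0)"
    and "\<And>i j. i < n \<Longrightarrow> j < n \<Longrightarrow> (\<Sum>x<n. U $$ (i, x) * cnj (U $$ (j, x))) = (if i = j then 1 else 0)"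
proof -
  note U = unitary_matD[OF assms]
  note aU = mat_adjoint_carrier[OF U(1)]
  fix i j assume ij: "i < n" "j < n"
  have "(\<Sum>x<n. mat_adjoint U $$ (i, x) * U $$ (x, j)) = 1\<^sub>m n $$ (i, j)"
    using mat_mult_index[OF aU U(1) ij] U(2) by simp
  moreover have "(\<Sum>x<n. mat_adjoint U $$ (i, x) * U $$ (x, j)) = (\<Sum>x<n. cnj (U $$ (x, i)) * U $$ (x, j))"
    by (rule sum.cong[OF refl]) (use ij U(1) in simp)
  ultimately show "(\<Sum>x<n. cnj (U $$ (x, i)) * U $$ (x, j)) = (if i = j then 1 else 0)"
    using ij by simp
  have "(\<Sum>x<n. U $$ (i, x) * mat_adjoint U $$ (x, j)) = 1\<^sub>m n $$ (i, j)"
    using mat_mult_index[OF U(1) aU ij] U(3) by simp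
  moreover have "(\<Sum>x<n. U $$ (i, x) * mat_adjoint U $$ (x, j)) = (\<Sum>x<n. U $$ (i, x) * cnj (U $$ (j, x)))"
    by (rule sum.cong[OF refl]) (use ij U(1) in simp)
  ultimately show "(\<Sum>x<n. U $$ (i, x) * cnj (U $$ (j, x))) = (if i = j then 1 else 0)"
    using ij by simp
qed

text \<open>The identity factor leaves \<open>i\<close> and \<open>j\<close> untouched, so
  \<open>G\<close> acts separately on each block of \<open>Z\<close>.\<close>

lemma conj_kron_one_index:
  assumes G: "G \<in> carrier_mat n n" and Z: "Z \<in> carrier_mat (m * n) (m * n)"
    and ix: "i < m" "k < n" "j < m" "l < n"
  shows "(kron (1\<^sub>m m) G * Z * mat_adjoint (kron (1\<^sub>m m) G)) $$ (i * n + k, j * n + l)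
    = (\<Sum>k'<n. \<Sum>l'<n. G $$ (k, k') * Z $$ (i * n + k', j * n + l') * cnj (G $$ (l, l')))"
proof -
  let ?K = "kron (1\<^sub>m m) G"
  have K: "?K \<in> carrier_mat (m * n) (m * n)" using G by simp
  note aK = mat_adjoint_carrier[OF K]
  note ixs = pair_index_less[OF ix(1,2)] pair_index_less[OF ix(3,4)]
  have L: "(?K * Z) $$ (i * n + k, c) = (\<Sum>k'<n. G $$ (k, k') * Z $$ (i * n + k', c))"
    if "c < m * n" for c
  proof -
    have "(?K * Z) $$ (i * n + k, c) = (\<Sum>i'<m. \<Sum>k'<n. ?K $$ (i * n + k, i' * n + k') * Z $$ (i' * n + k', c))"
      using mat_mult_index[OF K Z ixs(1) that] by (simp only: sum_pair_index)
    also have "\<dots> = (\<Sum>i'<m. if i' = i then (\<Sum>k'<n. G $$ (k, k') * Z $$ (i * n + k', c)) else 0)"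
      by (rule sum.cong[OF refl]) (use ix in \<open>auto simp: kron_index[OF one_carrier_mat G]\<close>)
    finally show ?thesis using ix by simp
  qed
  have "(?K * Z * mat_adjoint ?K) $$ (i * n + k, j * n + l)
      = (\<Sum>j'<m. \<Sum>l'<n. (?K * Z) $$ (i * n + k, j' * n + l') * mat_adjoint ?K $$ (j' * n + l', j * n + l))"
    using mat_mult_index[OF mult_carrier_mat[OF K Z] aK ixs] by (simp only: sum_pair_index)
  also have "\<dots> = (\<Sum>j'<m. if j' = j then (\<Sum>l'<n. (?K * Z) $$ (i * n + k, j * n + l') * cnj (G $$ (l, l'))) else 0)"
  proof (rule sum.cong[OF refl])
    fix j' assume "j' \<in> {..<m}"
    then have j': "j' < m" by simp
    have "mat_adjoint ?K $$ (j' * n + l', j * n + l) = (if j' = j then cnj (G $$ (l, l')) else 0)"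
      if "l' < n" for l'
    proof -
      have "mat_adjoint ?K $$ (j' * n + l', j * n + l) = cnj (?K $$ (j * n + l, j' * n + l'))"
        using K pair_index_less[OF j' that] ixs by (intro mat_adjoint_index) auto
      then show ?thesis using ix j' that by (simp add: kron_index[OF one_carrier_mat G])
    qed
    then show "(\<Sum>l'<n. (?K * Z) $$ (i * n + k, j' * n + l') * mat_adjoint ?K $$ (j' * n + l', j * n + l))
        = (if j' = j then (\<Sum>l'<n. (?K * Z) $$ (i * n + k, j * n + l') * cnj (G $$ (l, l'))) else 0)"
      by simp
  qed
  also have "\<dots> = (\<Sum>l'<n. (?K * Z) $$ (i * n + k, j * n + l') * cnj (G $$ (l, l')))"
    using ix by simp
  also have "\<dots> = (\<Sum>l'<n. \<Sum>k'<n. G $$ (k, k') * Z $$ (i * n + k', j * n + l') * cnj (G $$ (l, l')))"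
    unfolding sum_distrib_right[symmetric]
    by (rule sum.cong[OF refl]) (use ix in \<open>simp add: L pair_index_less\<close>)
  also have "\<dots> = (\<Sum>k'<n. \<Sum>l'<n. G $$ (k, k') * Z $$ (i * n + k', j * n + l') * cnj (G $$ (l, l')))"
    by (rule sum.swap)
  finally show ?thesis .
qed

text \<open>Tracing out the rotated factor contracts two columns of \<open>G\<close>, which are
  orthonormal. Hence the implemented map does not notice a rotation of the catalyst after the
  interaction.\<close>

lemma ptrace_snd_conj_kron_one:
  assumes G: "unitary_mat n G" and Z: "Z \<in> carrier_mat (m * n) (m * n)"
  shows "ptrace_snd m n (kron (1\<^sub>m m) G * Z * mat_adjoint (kron (1\<^sub>m m) G)) = ptrace_snd m n Z"
proof (rule eq_matI)
  fix i j assume "i < dim_row (ptrace_snd m n Z)" "j < dim_col (ptrace_snd m n Z)"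
  then have ij: "i < m" "j < m" by (auto simp: ptrace_snd_def)
  have "(\<Sum>k<n. (kron (1\<^sub>m m) G * Z * mat_adjoint (kron (1\<^sub>m m) G)) $$ (i * n + k, j * n + k))
      = (\<Sum>k<n. \<Sum>k'<n. \<Sum>l'<n. Z $$ (i * n + k', j * n + l') * (cnj (G $$ (k, l')) * G $$ (k, k')))"
    by (rule sum.cong[OF refl])
       (use ij in \<open>simp add: conj_kron_one_index[OF unitary_matD(1)[OF G] Z] mult_ac\<close>)
  also have "\<dots> = (\<Sum>k'<n. \<Sum>l'<n. \<Sum>k<n. Z $$ (i * n + k', j * n + l') * (cnj (G $$ (k, l')) * G $$ (k, k')))"
    by (subst sum.swap, rule sum.cong[OF refl], rule sum.swap)
  also have "\<dots> = (\<Sum>k'<n. \<Sum>l'<n. if l' = k' then Z $$ (i * n + k', j * n + k') else 0)"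
    by (intro sum.cong refl, subst sum_distrib_left[symmetric]) (auto simp: unitary_mat_sums(1)[OF G])
  finally show "ptrace_snd m n (kron (1\<^sub>m m) G * Z * mat_adjoint (kron (1\<^sub>m m) G)) $$ (i, j)
      = ptrace_snd m n Z $$ (i, j)"
    using ij by (simp add: ptrace_snd_def)
qed (auto simp: ptrace_snd_def)

text \<open>Conjugation by \<open>G\<close> is linear and acts on the same block indices for every
  \<open>i\<close>, so it commutes with the sum over \<open>i\<close>. It carries the catalyst
  condition to a rotated frame.\<close>

lemma ptrace_fst_conj_kron_one:
  assumes G: "G \<in> carrier_mat n n" and Z: "Z \<in> carrier_mat (m * n) (m * n)"
  shows "ptrace_fst m n (kron (1\<^sub>m m) G * Z * mat_adjoint (kron (1\<^sub>m m) G))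
    = G * ptrace_fst m n Z * mat_adjoint G"
proof (rule eq_matI)
  have P: "ptrace_fst m n Z \<in> carrier_mat n n" by (simp add: ptrace_fst_def)
  fix k l assume "k < dim_row (G * ptrace_fst m n Z * mat_adjoint G)" "l < dim_col (G * ptrace_fst m n Z * mat_adjoint G)"
  then have kl: "k < n" "l < n" using G by auto
  have "(\<Sum>i<m. (kron (1\<^sub>m m) G * Z * mat_adjoint (kron (1\<^sub>m m) G)) $$ (i * n + k, i * n + l))
      = (\<Sum>i<m. \<Sum>k'<n. \<Sum>l'<n. G $$ (k, k') * Z $$ (i * n + k', i * n + l') * cnj (G $$ (l, l')))"
    by (rule sum.cong[OF refl]) (use kl in \<open>simp add: conj_kron_one_index[OF G Z]\<close>)
  also have "\<dots> = (\<Sum>k'<n. \<Sum>l'<n. \<Sum>i<m. G $$ (k, k') * Z $$ (i * n + k', i * n + l') * cnj (G $$ (l, l')))"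
    by (subst sum.swap, rule sum.cong[OF refl], rule sum.swap)
  also have "\<dots> = (\<Sum>l'<n. \<Sum>k'<n. \<Sum>i<m. G $$ (k, k') * Z $$ (i * n + k', i * n + l') * cnj (G $$ (l, l')))"
    by (rule sum.swap)
  also have "\<dots> = (\<Sum>l'<n. (\<Sum>k'<n. G $$ (k, k') * ptrace_fst m n Z $$ (k', l')) * mat_adjoint G $$ (l', l))"
    by (rule sum.cong[OF refl])
       (use kl G in \<open>simp add: ptrace_fst_def sum_distrib_left sum_distrib_right\<close>)
  also have "\<dots> = (\<Sum>l'<n. (G * ptrace_fst m n Z) $$ (k, l') * mat_adjoint G $$ (l', l))"
    by (rule sum.cong[OF refl]) (use kl in \<open>simp add: mat_mult_index[OF G P] del: index_mult_mat(1)\<close>)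
  also have "\<dots> = (G * ptrace_fst m n Z * mat_adjoint G) $$ (k, l)"
    by (rule mat_mult_index[symmetric, OF mult_carrier_mat[OF G P] mat_adjoint_carrier[OF G] kl])
  finally show "ptrace_fst m n (kron (1\<^sub>m m) G * Z * mat_adjoint (kron (1\<^sub>m m) G)) $$ (k, l)
      = (G * ptrace_fst m n Z * mat_adjoint G) $$ (k, l)"
    using kl by (simp add: ptrace_fst_def)
qed (use G in \<open>auto simp: ptrace_fst_def\<close>)

subsection \<open>Entropy bound\<close>

text \<open>\<open>W y l p k\<close> is the amplitude from input \<open>p\<close> and catalyst level
  \<open>k\<close> to output \<open>y\<close> and level \<open>l\<close>; \<open>g\<close> with
  weights \<open>q\<close> is the input ensemble, \<open>e\<close> and \<open>lam\<close>
  diagonalise the output, and \<open>R\<close> is the reference, left abstract so that it can be a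
  set of pairs. Hypothesis \<open>eq\<close> is the Kraus form with operators indexed by
  \<open>(k, l)\<close>. The entropy of the joint weights \<open>q t * s k\<close> splits; its
  \<open>q\<close> part gives the input entropy, and its \<open>s\<close> part joins the logarithms
  of the block sizes.\<close>

lemma catalytic_entropy_bound:
  fixes g :: "'t \<Rightarrow> 'x \<times> nat \<Rightarrow> complex" and e :: "'m \<Rightarrow> 'x \<times> nat \<Rightarrow> complex"
    and W :: "nat \<Rightarrow> nat \<Rightarrow> nat \<Rightarrow> nat \<Rightarrow> complex"
  assumes fin: "finite T" "finite I" "finite R"
    and q: "\<And>t. t \<in> T \<Longrightarrow> 0 \<le> q t" "(\<Sum>t\<in>T. q t) = 1"
    and s: "\<And>k. k < b \<Longrightarrow> 0 \<le> s k" "(\<Sum>k<b. s k) = 1"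
    and norm_g: "\<And>t. t \<in> T \<Longrightarrow> (\<Sum>z\<in>R \<times> {..<a}. (cmod (g t z))\<^sup>2) = 1"
    and iso: "\<And>k v. k < b \<Longrightarrow>
      (\<Sum>y<a. \<Sum>l<b. (cmod (\<Sum>p<a. W y l p k * v p))\<^sup>2) = (\<Sum>p<a. (cmod (v p))\<^sup>2)"
    and block: "\<And>y l p k. y < a \<Longrightarrow> l < b \<Longrightarrow> p < a \<Longrightarrow> k < b \<Longrightarrow> s l \<noteq> s k \<Longrightarrow> W y l p k = 0"
    and orth: "\<And>m n. m \<in> I \<Longrightarrow> n \<in> I \<Longrightarrow>
      (\<Sum>z\<in>R \<times> {..<a}. e m z * cnj (e n z)) = (if m = n then 1 else 0)"
    and compl: "\<And>z z'. z \<in> R \<times> {..<a} \<Longrightarrow> z' \<in> R \<times> {..<a} \<Longrightarrow>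
      (\<Sum>m\<in>I. e m z * cnj (e m z')) = (if z = z' then 1 else 0)"
    and eq: "\<And>x y x' y'. x \<in> R \<Longrightarrow> y < a \<Longrightarrow> x' \<in> R \<Longrightarrow> y' < a \<Longrightarrow>
      (\<Sum>m\<in>I. of_real (lam m) * (e m (x, y) * cnj (e m (x', y'))))
      = (\<Sum>p<a. \<Sum>p'<a. (\<Sum>t\<in>T. of_real (q t) * (g t (x, p) * cnj (g t (x', p'))))
          * (\<Sum>k<b. \<Sum>l<b. of_real (s k) * (W y l p k * cnj (W y' l p' k))))"
  shows "- (\<Sum>m\<in>I. lam m * log 2 (lam m)) + (\<Sum>t\<in>T. q t * log 2 (q t))
    \<le> - (\<Sum>k<b. s k * log 2 (s k / real (card {l\<in>{..<b}. s l = s k})))"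
proof -
  define A where "A t k l x y = (\<Sum>p<a. W y l p k * g t (x, p))" for t k l x y
  \<comment> \<open>The unnormalised output vector for input \<open>t\<close> when the catalyst goes
    from level \<open>k\<close> to level \<open>l\<close>; the square root makes its squared norm
    the weight \<open>w t k l\<close>.\<close>
  define u where "u = (\<lambda>(t, k, l) (x, y). of_real (sqrt (q t * s k)) * A t k l x y)"
  define w where "w t k l = (\<Sum>(x, y)\<in>R \<times> {..<a}. (cmod (u (t, k, l) (x, y)))\<^sup>2)" for t k l
  let ?K = "T \<times> {..<b} \<times> {..<b}"
  let ?r = "\<lambda>k. real (card {l\<in>{..<b}. s l = s k})"
  have qs: "0 \<le> q t * s k" if "t \<in> T" "k < b" for t k using q s that by simp
  have weights: "w t k l = q t * s k * (\<Sum>x\<in>R. \<Sum>y<a. (cmod (A t k l x y))\<^sup>2)" if "t \<in> T" "k < b" for t k l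
    using qs[OF that]
    by (simp add: w_def u_def norm_mult power_mult_distrib sum.cartesian_product[symmetric] sum_distrib_left
        abs_mult)
  \<comment> \<open>Summing over the final level restores the norm of the input vector, by the
    isometry property, so only the prior weight remains.\<close>
  have w_sum: "(\<Sum>l<b. w t k l) = q t * s k" if t: "t \<in> T" and k: "k < b" for t k
  proof -
    have "(\<Sum>l<b. w t k l) = q t * s k * (\<Sum>l<b. \<Sum>x\<in>R. \<Sum>y<a. (cmod (A t k l x y))\<^sup>2)"
      using t k by (simp add: weights sum_distrib_left)
    also have "(\<Sum>l<b. \<Sum>x\<in>R. \<Sum>y<a. (cmod (A t k l x y))\<^sup>2) = (\<Sum>x\<in>R. \<Sum>y<a. \<Sum>l<b. (cmod (A t k l x y))\<^sup>2)"
      by (subst sum.swap, rule sum.cong[OF refl], rule sum.swap)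
    also have "\<dots> = (\<Sum>x\<in>R. \<Sum>p<a. (cmod (g t (x, p)))\<^sup>2)"
      unfolding A_def by (rule sum.cong[OF refl], rule iso[OF k])
    also have "\<dots> = 1"
      using norm_g[OF t] by (simp add: sum.cartesian_product case_prod_unfold)
    finally show ?thesis by simp
  qed
  have w_nn: "0 \<le> w t k l" for t k l unfolding w_def by (intro sum_nonneg) auto
  have w_block: "w t k l = 0" if "t \<in> T" "k < b" "l < b" "s l \<noteq> s k" for t k l
    unfolding weights[OF that(1,2)] by (simp add: A_def block that)
  have "- (\<Sum>m\<in>I. lam m * log 2 (lam m)) \<le> - (\<Sum>(t, k, l)\<in>?K. w t k l * log 2 (w t k l))"
  proof -
    have "- (\<Sum>m\<in>I. lam m * log 2 (lam m))
        \<le> - (\<Sum>h\<in>?K. (case h of (t, k, l) \<Rightarrow> w t k l) * log 2 (case h of (t, k, l) \<Rightarrow> w t k l))"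
    proof (rule spectral_entropy_le_ensemble[where e = e and u = u and X = "R \<times> {..<a}"])
      fix z z' assume "z \<in> R \<times> {..<a}" "z' \<in> R \<times> {..<a}"
      then obtain x y x' y' where z: "z = (x, y)" "z' = (x', y')" "x \<in> R" "x' \<in> R" "y < a" "y' < a"
        by auto
      have uu: "u (t, k, l) (x, y) * cnj (u (t, k, l) (x', y'))
          = of_real (q t * s k) * (\<Sum>p<a. \<Sum>p'<a. (W y l p k * g t (x, p)) * (cnj (W y' l p' k) * cnj (g t (x', p'))))"
        if "t \<in> T" "k < b" for t k l
      proof -
        have "complex_of_real (sqrt (q t * s k)) * of_real (sqrt (q t * s k)) = of_real (q t * s k)"
          using qs[OF that] unfolding of_real_mult[symmetric] by simp
        then have "u (t, k, l) (x, y) * cnj (u (t, k, l) (x', y')) = of_real (q t * s k) * (A t k l x y * cnj (A t k l x' y'))"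
          by (simp add: u_def del: of_real_mult)
        then show ?thesis unfolding A_def cnj_sum complex_cnj_mult sum_product .
      qed
      have "(\<Sum>m\<in>I. of_real (lam m) * (e m z * cnj (e m z')))
          = (\<Sum>p<a. \<Sum>p'<a. \<Sum>t\<in>T. \<Sum>k<b. \<Sum>l<b.
              of_real (q t * s k) * ((W y l p k * g t (x, p)) * (cnj (W y' l p' k) * cnj (g t (x', p')))))"
        unfolding z(1,2) eq[OF z(3,5,4,6)]
        by (intro sum.cong refl, subst sum_distrib_right, intro sum.cong refl)
           (simp add: sum_distrib_left mult_ac)
      also have "\<dots> = (\<Sum>p<a. \<Sum>p'<a. \<Sum>(t, k, l)\<in>?K.
              of_real (q t * s k) * ((W y l p k * g t (x, p)) * (cnj (W y' l p' k) * cnj (g t (x', p')))))"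
        by (simp add: sum.cartesian_product)
      also have "\<dots> = (\<Sum>p<a. \<Sum>h\<in>?K. \<Sum>p'<a. case h of (t, k, l) \<Rightarrow>
              of_real (q t * s k) * ((W y l p k * g t (x, p)) * (cnj (W y' l p' k) * cnj (g t (x', p')))))"
        by (rule sum.cong[OF refl], rule sum.swap)
      also have "\<dots> = (\<Sum>h\<in>?K. \<Sum>p<a. \<Sum>p'<a. case h of (t, k, l) \<Rightarrow>
              of_real (q t * s k) * ((W y l p k * g t (x, p)) * (cnj (W y' l p' k) * cnj (g t (x', p')))))"
        by (rule sum.swap)
      also have "\<dots> = (\<Sum>h\<in>?K. u h z * cnj (u h z'))"
      proof (rule sum.cong[OF refl])
        fix h assume "h \<in> ?K"
        then obtain t k l where h: "h = (t, k, l)" "t \<in> T" "k < b" by auto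
        show "(\<Sum>p<a. \<Sum>p'<a. case h of (t, k, l) \<Rightarrow>
              of_real (q t * s k) * ((W y l p k * g t (x, p)) * (cnj (W y' l p' k) * cnj (g t (x', p')))))
            = u h z * cnj (u h z')"
          unfolding h(1) z(1,2) uu[OF h(2,3)] prod.case sum_distrib_left ..
      qed
      finally show "(\<Sum>m\<in>I. of_real (lam m) * (e m z * cnj (e m z'))) = (\<Sum>h\<in>?K. u h z * cnj (u h z'))" .
    next
      fix h assume "h \<in> ?K"
      then show "(case h of (t, k, l) \<Rightarrow> w t k l) = (\<Sum>z\<in>R \<times> {..<a}. (cmod (u h z))\<^sup>2)"
        by (auto simp: w_def case_prod_unfold)
    qed (use fin orth compl in auto)
    then show ?thesis by (simp add: case_prod_unfold)
  qed
  also have "\<dots> = (\<Sum>t\<in>T. \<Sum>k<b. - (\<Sum>l<b. w t k l * log 2 (w t k l)))"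
    by (simp add: sum.cartesian_product sum_negf)
  \<comment> \<open>For fixed \<open>t\<close> and \<open>k\<close> the weights over
    \<open>l\<close> live on the levels with eigenvalue \<open>s k\<close> and have total mass
    \<open>q t * s k\<close>.\<close>
  also have "\<dots> \<le> (\<Sum>t\<in>T. \<Sum>k<b. q t * s k * log 2 (?r k) - q t * s k * log 2 (q t * s k))"
  proof (intro sum_mono)
    fix t k assume "t \<in> T" "k \<in> {..<b}"
    then show "- (\<Sum>l<b. w t k l * log 2 (w t k l)) \<le> q t * s k * log 2 (?r k) - q t * s k * log 2 (q t * s k)"
      by (intro block_entropy_le) (auto simp: w_nn w_block w_sum)
  qed
  also have "\<dots> = (\<Sum>t\<in>T. q t) * (\<Sum>k<b. s k * log 2 (?r k)) - (\<Sum>t\<in>T. \<Sum>k<b. q t * s k * log 2 (q t * s k))"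
    by (simp add: sum_subtractf sum_product mult.assoc)
  also have "\<dots> = (\<Sum>k<b. s k * log 2 (?r k)) - (\<Sum>t\<in>T. q t * log 2 (q t)) - (\<Sum>k<b. s k * log 2 (s k))"
    by (subst product_entropy) (use q s in auto)
  also have "\<dots> = - (\<Sum>t\<in>T. q t * log 2 (q t)) - (\<Sum>k<b. s k * log 2 (s k / ?r k))"
  proof -
    \<comment> \<open>The block size is positive since the block contains \<open>k\<close> itself;
      for \<open>s k = 0\<close> both sides vanish.\<close>
    have "s k * log 2 (s k / ?r k) = s k * log 2 (s k) - s k * log 2 (?r k)" if "k < b" for k
    proof (cases "s k = 0")
      case False
      have "0 < ?r k" unfolding of_nat_0_less_iff card_gt_0_iff using that by auto
      moreover have "s k * log 2 (s k / r) = s k * log 2 (s k) - s k * log 2 r" if "0 < r" for r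
        using that False s(1)[OF \<open>k < b\<close>] by (simp add: log_divide right_diff_distrib)
      ultimately show ?thesis by blast
    qed simp
    then show ?thesis by (simp add: sum_subtractf)
  qed
  finally show ?thesis by simp
qed

text \<open>With the catalyst level \<open>k\<close> held fixed, the columns
  \<open>p * b + k\<close> of \<open>M\<close> are orthonormal.\<close>

lemma isometry_of_unitary:
  assumes M: "unitary_mat (a * b) M" and k: "k < b"
  shows "(\<Sum>y<a. \<Sum>l<b. (cmod (\<Sum>p<a. M $$ (y * b + l, p * b + k) * v p))\<^sup>2) = (\<Sum>p<a. (cmod (v p))\<^sup>2)"
proof -
  have "complex_of_real (\<Sum>y<a. \<Sum>l<b. (cmod (\<Sum>p<a. M $$ (y * b + l, p * b + k) * v p))\<^sup>2)
      = of_real (\<Sum>r<a * b. (cmod (\<Sum>p<a. M $$ (r, p * b + k) * v p))\<^sup>2)"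
    unfolding sum_pair_index ..
  also have "\<dots> = (\<Sum>r<a * b. (\<Sum>p<a. M $$ (r, p * b + k) * v p) * cnj (\<Sum>p<a. M $$ (r, p * b + k) * v p))"
    unfolding of_real_sum by (rule sum.cong[OF refl], rule complex_norm_square)
  also have "\<dots> = (\<Sum>r<a * b. \<Sum>p<a. \<Sum>p'<a. v p * cnj (v p') * (cnj (M $$ (r, p' * b + k)) * M $$ (r, p * b + k)))"
    unfolding cnj_sum sum_product by (simp add: mult_ac)
  also have "\<dots> = (\<Sum>p<a. \<Sum>p'<a. \<Sum>r<a * b. v p * cnj (v p') * (cnj (M $$ (r, p' * b + k)) * M $$ (r, p * b + k)))"
    by (subst sum.swap, rule sum.cong[OF refl], rule sum.swap)
  also have "\<dots> = (\<Sum>p<a. \<Sum>p'<a. if p' = p then v p * cnj (v p) else 0)"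
  proof (intro sum.cong refl)
    fix p p' assume "p \<in> {..<a}" "p' \<in> {..<a}"
    then have "p * b + k < a * b" "p' * b + k < a * b" using k by (auto intro: pair_index_less)
    then show "(\<Sum>r<a * b. v p * cnj (v p') * (cnj (M $$ (r, p' * b + k)) * M $$ (r, p * b + k)))
        = (if p' = p then v p * cnj (v p) else 0)"
      using k by (subst sum_distrib_left[symmetric]) (simp add: unitary_mat_sums(1)[OF M])
  qed
  also have "\<dots> = (\<Sum>p<a. v p * cnj (v p))" by simp
  also have "\<dots> = of_real (\<Sum>p<a. (cmod (v p))\<^sup>2)"
    unfolding of_real_sum by (rule sum.cong[OF refl], rule complex_norm_square[symmetric])
  finally show ?thesis using of_real_eq_iff by blast
qed

text \<open>This is the reason why a catalytic unitary preserves the eigenspaces of its catalyst: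
  \<open>m\<close> collects the squared moduli of the blocks, and \<open>\<Sum> m\<^sub>l\<^sub>k (s\<^sub>k - s\<^sub>l)\<^sup>2\<close> vanishes.\<close>

lemma doubly_stochastic_fixed_vector:
  fixes m :: "nat \<Rightarrow> nat \<Rightarrow> real"
  assumes nn: "\<And>l k. l < b \<Longrightarrow> k < b \<Longrightarrow> 0 \<le> m l k"
    and row: "\<And>l. l < b \<Longrightarrow> (\<Sum>k<b. m l k) = 1" and col: "\<And>k. k < b \<Longrightarrow> (\<Sum>l<b. m l k) = 1"
    and fixed: "\<And>l. l < b \<Longrightarrow> (\<Sum>k<b. m l k * s k) = s l"
    and lk: "l < b" "k < b" "s l \<noteq> s k"
  shows "m l k = 0"
proof -
  have "(\<Sum>l<b. \<Sum>k<b. m l k * (s k - s l)\<^sup>2)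
      = (\<Sum>l<b. \<Sum>k<b. m l k * (s k)\<^sup>2) - (\<Sum>l<b. 2 * s l * (\<Sum>k<b. m l k * s k)) + (\<Sum>l<b. (s l)\<^sup>2 * (\<Sum>k<b. m l k))"
    unfolding sum_distrib_left sum_subtractf[symmetric] sum.distrib[symmetric]
    by (intro sum.cong refl) (simp add: power2_eq_square algebra_simps)
  also have "(\<Sum>l<b. \<Sum>k<b. m l k * (s k)\<^sup>2) = (\<Sum>k<b. (\<Sum>l<b. m l k) * (s k)\<^sup>2)"
    by (subst sum.swap) (simp only: sum_distrib_right)
  \<comment> \<open>With S the sum of the squares of \<open>s\<close>, the column sums turn the
    first term into S, the fixed-vector equation the second into 2 S, and the row sums the third
    into S.\<close>
  also have "(\<Sum>k<b. (\<Sum>l<b. m l k) * (s k)\<^sup>2) - (\<Sum>l<b. 2 * s l * (\<Sum>k<b. m l k * s k)) + (\<Sum>l<b. (s l)\<^sup>2 * (\<Sum>k<b. m l k)) = 0"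
    by (simp add: row col fixed power2_eq_square flip: sum_subtractf sum.distrib)
  finally have "(\<Sum>l<b. \<Sum>k<b. m l k * (s k - s l)\<^sup>2) = 0" .
  moreover have tm: "0 \<le> m l k * (s k - s l)\<^sup>2" if "l < b" "k < b" for l k using nn[OF that] by simp
  ultimately have "(\<Sum>k<b. m l k * (s k - s l)\<^sup>2) = 0"
    using lk(1) by (subst (asm) sum_nonneg_eq_0_iff) (auto intro!: sum_nonneg tm)
  then have "m l k * (s k - s l)\<^sup>2 = 0"
    using lk by (subst (asm) sum_nonneg_eq_0_iff) (auto intro!: tm)
  then show ?thesis using lk(3) by simp
qed

section \<open>Test states and polarization\<close>

lemma quadratic_form:
  fixes A :: "complex mat"
  assumes "A \<in> carrier_mat n n" "v \<in> carrier_vec n"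
  shows "(A *\<^sub>v v) \<bullet>c v = (\<Sum>x<n. (\<Sum>y<n. A $$ (x, y) * v $ y) * cnj (v $ x))"
  using assms by (simp add: scalar_prod_def lessThan_atLeast0)

lemma rank_one_state:
  fixes x :: "nat \<Rightarrow> complex"
  assumes N: "(\<Sum>p<n. (cmod (x p))\<^sup>2) = N" "0 < N"
  shows "quantum_state n (mat n n (\<lambda>(p, q). x p * cnj (x q) / of_real N))" (is "quantum_state n ?X")
proof -
  have X: "?X \<in> carrier_mat n n" by simp
  have "0 \<le> Re ((?X *\<^sub>v v) \<bullet>c v)" if v: "v \<in> carrier_vec n" for v
  proof -
    define c where "c = (\<Sum>p<n. x p * cnj (v $ p))"
    have "(?X *\<^sub>v v) \<bullet>c v = (\<Sum>p<n. (\<Sum>q<n. x p * cnj (x q) / of_real N * v $ q) * cnj (v $ p))"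
      unfolding quadratic_form[OF X v] by (intro sum.cong refl arg_cong2[where f = "(*)"]) auto
    also have "\<dots> = (\<Sum>p<n. \<Sum>q<n. (x p * cnj (v $ p)) * cnj (x q * cnj (v $ q)) / of_real N)"
      unfolding sum_distrib_right by (intro sum.cong refl) (simp add: mult_ac)
    also have "\<dots> = c * cnj c / of_real N"
      unfolding c_def cnj_sum sum_product sum_divide_distrib ..
    also have "\<dots> = of_real ((cmod c)\<^sup>2 / N)" by (simp only: of_real_divide complex_norm_square)
    finally show ?thesis using N(2) by simp
  qed
  moreover have "hermitian_mat n ?X" by (rule hermitian_matI) (auto simp: mult.commute)
  moreover have "mat_trace ?X = 1"
  proof -
    have "mat_trace ?X = (\<Sum>p<n. of_real ((cmod (x p))\<^sup>2)) / of_real N"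
      unfolding mat_trace_def sum_divide_distrib by (intro sum.cong) (auto simp: complex_norm_square simp del: of_real_power)
    also have "\<dots> = of_real N / of_real N" unfolding N(1)[symmetric] of_real_sum ..
    finally show ?thesis using N(2) by simp
  qed
  ultimately show ?thesis by (simp add: quantum_state_def psd_mat_def)
qed

text \<open>Serves as the input at which the catalyst condition is evaluated, and as a witness that
  the set defining the entropy production is nonempty.\<close>

lemma max_mixed_state:
  assumes "0 < n"
  shows "quantum_state n (max_mixed n)"
proof -
  have X: "max_mixed n \<in> carrier_mat n n" by (simp add: max_mixed_def)
  have "0 \<le> Re ((max_mixed n *\<^sub>v v) \<bullet>c v)" if v: "v \<in> carrier_vec n" for v
  proof -
    have "max_mixed n $$ (p, q) * v $ q = (if q = p then v $ p / of_nat n else 0)" if "p < n" "q < n" for p q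
      using that by (simp add: max_mixed_def)
    then have "(max_mixed n *\<^sub>v v) \<bullet>c v = (\<Sum>p<n. v $ p / of_nat n * cnj (v $ p))"
      unfolding quadratic_form[OF X v] by (intro sum.cong refl) simp
    also have "\<dots> = of_real (\<Sum>p<n. (cmod (v $ p))\<^sup>2 / real n)"
      unfolding of_real_sum by (rule sum.cong[OF refl]) (simp add: complex_norm_square del: of_real_power)
    finally show ?thesis by (simp add: sum_nonneg)
  qed
  moreover have "hermitian_mat n (max_mixed n)" by (rule hermitian_matI) (auto simp: max_mixed_def)
  moreover have "mat_trace (max_mixed n) = 1" using assms by (simp add: mat_trace_def max_mixed_def)
  ultimately show ?thesis by (simp add: quantum_state_def psd_mat_def)
qed

text \<open>Polarization: pure states already span all operators. This passes from the definition of
  an implementation, which quantifies over states, to matrix units, on which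
  \<open>map_tensor\<close> is built.\<close>

lemma functional_zero_on_states:
  fixes c :: "nat \<Rightarrow> nat \<Rightarrow> complex"
  assumes zero: "\<And>\<rho>. quantum_state n \<rho> \<Longrightarrow> (\<Sum>p<n. \<Sum>q<n. \<rho> $$ (p, q) * c p q) = 0"
    and pq: "p < n" "q < n"
  shows "c p q = 0"
proof -
  have form: "(\<Sum>p<n. \<Sum>q<n. x p * cnj (x q) * c p q) = 0" if "p0 < n" "x p0 \<noteq> 0" for x p0
  proof -
    define N where "N = (\<Sum>p<n. (cmod (x p))\<^sup>2)"
    have "0 < (cmod (x p0))\<^sup>2" using that by simp
    also have "\<dots> \<le> N" unfolding N_def by (rule member_le_sum) (use that in auto)
    finally have N: "0 < N" .
    have "0 = (\<Sum>p<n. \<Sum>q<n. x p * cnj (x q) / of_real N * c p q)"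
      using zero[OF rank_one_state[OF N_def[symmetric] N]] by simp
    also have "\<dots> = (\<Sum>p<n. \<Sum>q<n. x p * cnj (x q) * c p q) / of_real N"
      by (simp add: sum_divide_distrib)
    finally show ?thesis using N by simp
  qed
  have diag: "c p p = 0" if "p < n" for p
  proof -
    have "(\<Sum>p'<n. \<Sum>q<n. (if p' = p then 1 else 0) * cnj (if q = p then 1 else 0) * c p' q)
        = (\<Sum>p'<n. \<Sum>q<n. if q = p then (if p' = p then c p p else 0) else 0)"
      by (intro sum.cong refl) auto
    then show ?thesis using form[of p "\<lambda>z. if z = p then 1 else 0"] that by simp
  qed
  show ?thesis
  proof (cases "p = q")
    case True
    then show ?thesis using diag pq by simp
  next
    case ne: False
    \<comment> \<open>The test vector is 1 at \<open>p\<close> and \<open>w\<close> at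
      \<open>q\<close>. The diagonal coefficients are already known to vanish, and the values 1 and
      \<open>\<i>\<close> of \<open>w\<close> separate the two mixed ones.\<close>
    have two: "w * c q p + cnj w * c p q = 0" for w
    proof -
      define x where "x z = (if z = p then 1 else if z = q then w else 0)" for z
      have sub: "(\<Sum>z<n. x z * h z) = h p + w * h q" for h :: "nat \<Rightarrow> complex"
      proof -
        have "(\<Sum>z<n. x z * h z) = (\<Sum>z\<in>{p, q}. x z * h z)"
          by (rule sum.mono_neutral_right) (use pq in \<open>auto simp: x_def\<close>)
        then show ?thesis using ne by (simp add: x_def)
      qed
      have sub': "(\<Sum>z<n. cnj (x z) * h z) = h p + cnj w * h q" for h :: "nat \<Rightarrow> complex"
      proof -
        have "(\<Sum>z<n. cnj (x z) * h z) = (\<Sum>z\<in>{p, q}. cnj (x z) * h z)"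
          by (rule sum.mono_neutral_right) (use pq in \<open>auto simp: x_def\<close>)
        then show ?thesis using ne by (simp add: x_def)
      qed
      have "0 = (\<Sum>z<n. x z * (\<Sum>z'<n. cnj (x z') * c z z'))"
        using form[of p x] pq(1) by (simp add: x_def[of p] sum_distrib_left mult.assoc)
      also have "\<dots> = w * c q p + cnj w * c p q"
        unfolding sub sub' using diag pq by simp
      finally show ?thesis by simp
    qed
    from two[of 1] two[of \<i>] show ?thesis by (simp add: add_eq_0_iff)
  qed
qed

subsection \<open>Normal form of a catalytic implementation\<close>

lemma unitary_conj_cancel:
  assumes G: "unitary_mat n G" and XY: "X \<in> carrier_mat n n" "Y \<in> carrier_mat n n"
    and eq: "G * X * mat_adjoint G = G * Y * mat_adjoint G"
  shows "X = Y"
proof -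
  note Gc = unitary_matD[OF G] and aG = mat_adjoint_carrier[OF unitary_matD(1)[OF G]]
  have *: "mat_adjoint G * (G * X * mat_adjoint G) * G = X" if X: "X \<in> carrier_mat n n" for X
  proof -
    have "mat_adjoint G * (G * X * mat_adjoint G) * G = (mat_adjoint G * G) * (X * (mat_adjoint G * G))"
      using Gc(1) aG X by (simp add: assoc_mult_mat[of _ n n _ n _ n] mult_carrier_mat[of _ n n _ n])
    then show ?thesis using X by (simp add: Gc(2))
  qed
  show ?thesis by (rule trans[OF sym[OF *[OF XY(1), unfolded eq]] *[OF XY(2)]])
qed

lemma conj_kron_diag_index:
  assumes M: "M \<in> carrier_mat (a * b) (a * b)" and R: "\<rho> \<in> carrier_mat a a"
    and D: "D \<in> carrier_mat b b" "\<And>k l. k < b \<Longrightarrow> l < b \<Longrightarrow> D $$ (k, l) = (if k = l then of_real (s k) else 0)"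
    and r: "r < a * b" "r' < a * b"
  shows "(M * kron \<rho> D * mat_adjoint M) $$ (r, r') = (\<Sum>p<a. \<Sum>q<a. \<Sum>k<b.
      \<rho> $$ (p, q) * (of_real (s k) * (M $$ (r, p * b + k) * cnj (M $$ (r', q * b + k)))))"
proof -
  note K = kron_carrier[OF R D(1)] and aM = mat_adjoint_carrier[OF M]
  have MK: "(M * kron \<rho> D) $$ (r, q * b + k) = (\<Sum>p<a. M $$ (r, p * b + k) * (\<rho> $$ (p, q) * of_real (s k)))"
    if q: "q < a" and k: "k < b" for q k
  proof -
    have "(M * kron \<rho> D) $$ (r, q * b + k)
        = (\<Sum>p<a. \<Sum>k'<b. M $$ (r, p * b + k') * kron \<rho> D $$ (p * b + k', q * b + k))"
      using mat_mult_index[OF M K r(1) pair_index_less[OF q k]] by (simp only: sum_pair_index)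
    also have "\<dots> = (\<Sum>p<a. \<Sum>k'<b. if k' = k then M $$ (r, p * b + k) * (\<rho> $$ (p, q) * of_real (s k)) else 0)"
      by (intro sum.cong refl) (use q k in \<open>simp add: kron_index[OF R D(1)] D(2)\<close>)
    finally show ?thesis using k by simp
  qed
  have "(M * kron \<rho> D * mat_adjoint M) $$ (r, r')
      = (\<Sum>q<a. \<Sum>k<b. (M * kron \<rho> D) $$ (r, q * b + k) * mat_adjoint M $$ (q * b + k, r'))"
    using mat_mult_index[OF mult_carrier_mat[OF M K] aM r] by (simp only: sum_pair_index)
  also have "\<dots> = (\<Sum>q<a. \<Sum>k<b. (\<Sum>p<a. M $$ (r, p * b + k) * (\<rho> $$ (p, q) * of_real (s k))) * cnj (M $$ (r', q * b + k)))"
  proof (intro sum.cong refl arg_cong2[where f = "(*)"])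
    fix q k assume qk: "q \<in> {..<a}" "k \<in> {..<b}"
    then show "(M * kron \<rho> D) $$ (r, q * b + k) = (\<Sum>p<a. M $$ (r, p * b + k) * (\<rho> $$ (p, q) * of_real (s k)))"
      by (intro MK) auto
    show "mat_adjoint M $$ (q * b + k, r') = cnj (M $$ (r', q * b + k))"
      using M r qk pair_index_less[of q a k b] by (intro mat_adjoint_index) auto
  qed
  also have "\<dots> = (\<Sum>q<a. \<Sum>k<b. \<Sum>p<a. \<rho> $$ (p, q) * (of_real (s k) * (M $$ (r, p * b + k) * cnj (M $$ (r', q * b + k)))))"
    unfolding sum_distrib_right by (intro sum.cong refl) (simp only: mult_ac)
  also have "\<dots> = (\<Sum>q<a. \<Sum>p<a. \<Sum>k<b. \<rho> $$ (p, q) * (of_real (s k) * (M $$ (r, p * b + k) * cnj (M $$ (r', q * b + k)))))"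
    by (rule sum.cong[OF refl], rule sum.swap)
  also have "\<dots> = (\<Sum>p<a. \<Sum>q<a. \<Sum>k<b. \<rho> $$ (p, q) * (of_real (s k) * (M $$ (r, p * b + k) * cnj (M $$ (r', q * b + k)))))"
    by (rule sum.swap)
  finally show ?thesis .
qed

text \<open>Rotating the catalyst to its eigenbasis before the interaction and by \<open>V\<close> composed with
  this basis afterwards turns \<open>\<sigma>\<close> into a diagonal matrix that is preserved exactly.\<close>

lemma implemented_catalytically_diagonal:
  assumes impl: "implemented_catalytically a \<Phi> b \<sigma>" and es: "eigensystem b \<sigma> f s"
  obtains M D where "unitary_mat (a * b) M" "D \<in> carrier_mat b b"
    "\<And>k l. k < b \<Longrightarrow> l < b \<Longrightarrow> D $$ (k, l) = (if k = l then of_real (s k) else 0)"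
    "\<And>\<rho>. quantum_state a \<rho> \<Longrightarrow> ptrace_snd a b (M * kron \<rho> D * mat_adjoint M) = \<Phi> \<rho>"
    "\<And>\<rho>. quantum_state a \<rho> \<Longrightarrow> ptrace_fst a b (M * kron \<rho> D * mat_adjoint M) = D"
proof -
  obtain U V where U: "unitary_mat (a * b) U" and V: "unitary_mat b V"
    and impl': "\<And>\<rho>. quantum_state a \<rho> \<Longrightarrow> ptrace_snd a b (U * kron \<rho> \<sigma> * mat_adjoint U) = \<Phi> \<rho>"
      "\<And>\<rho>. quantum_state a \<rho> \<Longrightarrow> ptrace_fst a b (U * kron \<rho> \<sigma> * mat_adjoint U) = V * \<sigma> * mat_adjoint V"
    using impl unfolding implemented_catalytically_def by blast
  let ?N = "a * b"
  define F where "F = mat b b (\<lambda>(y, k). f k y)"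
  define D where "D = mat b b (\<lambda>(k, l). if k = l then complex_of_real (s k) else 0)"
  have Fc: "F \<in> carrier_mat b b" and Dc: "D \<in> carrier_mat b b" by (simp_all add: F_def D_def)
  have Di: "D $$ (k, l) = (if k = l then of_real (s k) else 0)" if "k < b" "l < b" for k l
    using that by (simp add: D_def)
  have aF: "mat_adjoint F \<in> carrier_mat b b" using Fc by simp
  have FF: "F * mat_adjoint F = 1\<^sub>m b"
  proof (rule eq_matI)
    fix x y assume "x < dim_row (1\<^sub>m b :: complex mat)" "y < dim_col (1\<^sub>m b :: complex mat)"
    then have xy: "x < b" "y < b" by auto
    have "(F * mat_adjoint F) $$ (x, y) = (\<Sum>k<b. f k x * cnj (f k y))"
      unfolding mat_mult_index[OF Fc aF xy] by (rule sum.cong[OF refl]) (use xy in \<open>simp add: F_def\<close>)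
    then show "(F * mat_adjoint F) $$ (x, y) = 1\<^sub>m b $$ (x, y)" using xy by (simp add: eigensystem_complete[OF es])
  qed (use Fc in auto)
  then have F: "unitary_mat b F"
    unfolding unitary_mat_def using Fc mat_mult_left_right_inverse[OF Fc aF FF] by simp
  have \<sigma>: "\<sigma> = F * D * mat_adjoint F"
  proof (rule eq_matI)
    fix x y assume "x < dim_row (F * D * mat_adjoint F)" "y < dim_col (F * D * mat_adjoint F)"
    then have xy: "x < b" "y < b" using Fc by auto
    have "(F * D * mat_adjoint F) $$ (x, y) = (\<Sum>l<b. (F * D) $$ (x, l) * mat_adjoint F $$ (l, y))"
      by (rule mat_mult_index[OF mult_carrier_mat[OF Fc Dc] aF xy])
    also have "\<dots> = (\<Sum>l<b. of_real (s l) * (f l x * cnj (f l y)))"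
    proof (rule sum.cong[OF refl])
      fix l assume "l \<in> {..<b}"
      then have l: "l < b" by simp
      have "(F * D) $$ (x, l) = (\<Sum>k<b. if k = l then f l x * of_real (s l) else 0)"
        unfolding mat_mult_index[OF Fc Dc xy(1) l]
        by (rule sum.cong[OF refl]) (use xy l in \<open>simp add: F_def D_def\<close>)
      then have "(F * D) $$ (x, l) = f l x * of_real (s l)" using l by simp
      moreover have "mat_adjoint F $$ (l, y) = cnj (f l y)" using Fc l xy by (simp add: F_def)
      ultimately show "(F * D) $$ (x, l) * mat_adjoint F $$ (l, y) = of_real (s l) * (f l x * cnj (f l y))"
        by simp
    qed
    finally show "\<sigma> $$ (x, y) = (F * D * mat_adjoint F) $$ (x, y)"
      using xy by (simp add: eigensystem_index[OF es])
  qed (use Fc eigensystem_carrier[OF es] in auto)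
  define G where "G = V * F"
  have G: "unitary_mat b G" unfolding G_def by (rule unitary_mult[OF V F])
  define K1 where "K1 = kron (1\<^sub>m a) F"
  define K2 where "K2 = kron (1\<^sub>m a) G"
  have K1: "unitary_mat ?N K1" and K2: "unitary_mat ?N K2"
    unfolding K1_def K2_def by (rule unitary_kron_one[OF F], rule unitary_kron_one[OF G])
  define M where "M = mat_adjoint K2 * (U * K1)"
  have M: "unitary_mat ?N M" unfolding M_def by (intro unitary_mult unitary_adjoint K1 K2 U)
  note Uc = unitary_matD(1)[OF U] and K1c = unitary_matD(1)[OF K1] and K2c = unitary_matD(1)[OF K2]
    and Vc = unitary_matD(1)[OF V] and Gc = unitary_matD(1)[OF G] and Mc = unitary_matD(1)[OF M]
  note adj = mat_adjoint_carrier[OF Uc] mat_adjoint_carrier[OF K1c] mat_adjoint_carrier[OF K2c]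
    mat_adjoint_carrier[OF Mc]
  note assoc = assoc_mult_mat[of _ ?N ?N _ ?N _ ?N] mult_carrier_mat[of _ ?N ?N _ ?N]
  have U_M: "U = K2 * M * mat_adjoint K1"
  proof -
    have "K2 * M * mat_adjoint K1 = (K2 * mat_adjoint K2) * (U * (K1 * mat_adjoint K1))"
      unfolding M_def using Uc K1c K2c adj by (simp add: assoc)
    then show ?thesis using Uc by (simp add: unitary_matD(3)[OF K1] unitary_matD(3)[OF K2])
  qed
  have conj: "U * kron \<rho> \<sigma> * mat_adjoint U = K2 * (M * kron \<rho> D * mat_adjoint M) * mat_adjoint K2"
    if R: "\<rho> \<in> carrier_mat a a" for \<rho>
  proof -
    note T = kron_carrier[OF R Dc]
    have "K1 * kron \<rho> D * mat_adjoint K1 = kron \<rho> \<sigma>"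
      unfolding K1_def kron_adjoint[OF one_carrier_mat Fc] kron_mult[OF one_carrier_mat R Fc Dc] \<sigma>
      using R by (subst kron_mult[of _ a _ _ b]) (use Fc Dc aF R in auto)
    then have "U * kron \<rho> \<sigma> * mat_adjoint U
        = K2 * M * mat_adjoint K1 * (K1 * kron \<rho> D * mat_adjoint K1) * mat_adjoint (K2 * M * mat_adjoint K1)"
      using U_M by simp
    also have "mat_adjoint (K2 * M * mat_adjoint K1) = K1 * (mat_adjoint M * mat_adjoint K2)"
      using mat_adjoint_mult[OF mult_carrier_mat[OF K2c Mc] adj(2)] mat_adjoint_mult[OF K2c Mc] by simp
    also have "K2 * M * mat_adjoint K1 * (K1 * kron \<rho> D * mat_adjoint K1) * (K1 * (mat_adjoint M * mat_adjoint K2))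
        = K2 * (M * ((mat_adjoint K1 * K1) * (kron \<rho> D * ((mat_adjoint K1 * K1) * (mat_adjoint M * mat_adjoint K2)))))"
      using K1c K2c Mc T adj by (simp add: assoc)
    also have "\<dots> = K2 * (M * (kron \<rho> D * (mat_adjoint M * mat_adjoint K2)))"
      unfolding unitary_matD(2)[OF K1] using T adj Mc K2c
      by (simp add: mult_carrier_mat[of _ ?N ?N _ ?N] left_mult_one_mat[of _ ?N ?N])
    also have "\<dots> = K2 * (M * kron \<rho> D * mat_adjoint M) * mat_adjoint K2"
      using K2c Mc T adj by (simp add: assoc)
    finally show ?thesis .
  qed
  have rc: "\<rho> \<in> carrier_mat a a" if "quantum_state a \<rho>" for \<rho>
    using that by (simp add: quantum_state_def psd_mat_def hermitian_mat_def)
  have Zc: "M * kron \<rho> D * mat_adjoint M \<in> carrier_mat ?N ?N" if "quantum_state a \<rho>" for \<rho>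
    using Mc adj(4) kron_carrier[OF rc[OF that] Dc] by (simp add: mult_carrier_mat[of _ ?N ?N _ ?N])
  show ?thesis
  proof
    show "unitary_mat ?N M" by (rule M)
    show "D \<in> carrier_mat b b" by (rule Dc)
    show "D $$ (k, l) = (if k = l then of_real (s k) else 0)" if "k < b" "l < b" for k l
      by (rule Di[OF that])
  next
    fix \<rho> assume st: "quantum_state a \<rho>"
    show "ptrace_snd a b (M * kron \<rho> D * mat_adjoint M) = \<Phi> \<rho>"
      using impl'(1)[OF st] ptrace_snd_conj_kron_one[OF G Zc[OF st]]
      unfolding conj[OF rc[OF st]] K2_def by simp
    have "G * ptrace_fst a b (M * kron \<rho> D * mat_adjoint M) * mat_adjoint G = V * \<sigma> * mat_adjoint V"
      using impl'(2)[OF st] ptrace_fst_conj_kron_one[OF Gc Zc[OF st]]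
      unfolding conj[OF rc[OF st]] K2_def by simp
    also have "\<dots> = G * D * mat_adjoint G"
      unfolding G_def \<sigma> mat_adjoint_mult[OF Vc Fc]
      using Vc Fc Dc aF mat_adjoint_carrier[OF Vc]
      by (simp add: assoc_mult_mat[of _ b b _ b _ b] mult_carrier_mat[of _ b b _ b])
    finally show "ptrace_fst a b (M * kron \<rho> D * mat_adjoint M) = D"
      by (intro unitary_conj_cancel[OF G _ Dc]) (auto simp: ptrace_fst_def)
  qed
qed

text \<open>Tracing out the catalyst in the rotated frame gives Kraus operators that are the blocks
  of \<open>M\<close> from level \<open>k\<close> to level \<open>l\<close>, scaled by the square
  root of \<open>s k\<close>. Preservation of the catalyst makes the blocks between different
  eigenvalues vanish. Positivity of \<open>a\<close> provides the maximally mixed input used for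
  this.\<close>

lemma catalytic_normal_form:
  assumes a: "0 < a" and impl: "implemented_catalytically a \<Phi> b \<sigma>" and es: "eigensystem b \<sigma> f s"
  obtains M where "unitary_mat (a * b) M"
    "\<And>\<rho> y y'. quantum_state a \<rho> \<Longrightarrow> y < a \<Longrightarrow> y' < a \<Longrightarrow> \<Phi> \<rho> $$ (y, y') =
      (\<Sum>p<a. \<Sum>q<a. \<rho> $$ (p, q) *
        (\<Sum>k<b. \<Sum>l<b. of_real (s k) * (M $$ (y * b + l, p * b + k) * cnj (M $$ (y' * b + l, q * b + k)))))"
    "\<And>y l p k. y < a \<Longrightarrow> l < b \<Longrightarrow> p < a \<Longrightarrow> k < b \<Longrightarrow> s l \<noteq> s k \<Longrightarrow> M $$ (y * b + l, p * b + k) = 0"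
proof -
  obtain M D where M: "unitary_mat (a * b) M" and D: "D \<in> carrier_mat b b"
    "\<And>k l. k < b \<Longrightarrow> l < b \<Longrightarrow> D $$ (k, l) = (if k = l then of_real (s k) else 0)"
    and pt: "\<And>\<rho>. quantum_state a \<rho> \<Longrightarrow> ptrace_snd a b (M * kron \<rho> D * mat_adjoint M) = \<Phi> \<rho>"
      "\<And>\<rho>. quantum_state a \<rho> \<Longrightarrow> ptrace_fst a b (M * kron \<rho> D * mat_adjoint M) = D"
    using implemented_catalytically_diagonal[OF impl es] by blast
  note Mc = unitary_matD(1)[OF M]
  have rc: "\<rho> \<in> carrier_mat a a" if "quantum_state a \<rho>" for \<rho>
    using that by (simp add: quantum_state_def psd_mat_def hermitian_mat_def)
  show ?thesis
  proof
    show "unitary_mat (a * b) M" by (rule M)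
  next
    fix \<rho> y y' assume st: "quantum_state a \<rho>" and y: "y < a" "y' < a"
    let ?h = "\<lambda>l p q k. \<rho> $$ (p, q) * (of_real (s k) * (M $$ (y * b + l, p * b + k) * cnj (M $$ (y' * b + l, q * b + k))))"
    have "\<Phi> \<rho> $$ (y, y') = (\<Sum>l<b. (M * kron \<rho> D * mat_adjoint M) $$ (y * b + l, y' * b + l))"
      unfolding pt(1)[OF st, symmetric] using y by (simp add: ptrace_snd_def)
    also have "\<dots> = (\<Sum>l<b. \<Sum>p<a. \<Sum>q<a. \<Sum>k<b. ?h l p q k)"
      by (rule sum.cong[OF refl], rule conj_kron_diag_index[OF Mc rc[OF st] D]) (use y in \<open>auto intro: pair_index_less\<close>)
    also have "\<dots> = (\<Sum>p<a. \<Sum>l<b. \<Sum>q<a. \<Sum>k<b. ?h l p q k)" by (rule sum.swap)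
    also have "\<dots> = (\<Sum>p<a. \<Sum>q<a. \<Sum>l<b. \<Sum>k<b. ?h l p q k)" by (rule sum.cong[OF refl], rule sum.swap)
    also have "\<dots> = (\<Sum>p<a. \<Sum>q<a. \<Sum>k<b. \<Sum>l<b. ?h l p q k)"
      by (rule sum.cong[OF refl], rule sum.cong[OF refl], rule sum.swap)
    finally show "\<Phi> \<rho> $$ (y, y') = (\<Sum>p<a. \<Sum>q<a. \<rho> $$ (p, q) *
        (\<Sum>k<b. \<Sum>l<b. of_real (s k) * (M $$ (y * b + l, p * b + k) * cnj (M $$ (y' * b + l, q * b + k)))))"
      unfolding sum_distrib_left .
  next
    \<comment> \<open>The probability of finding the catalyst in level \<open>l\<close> when it
      starts in level \<open>k\<close> and the system is maximally mixed. Orthonormal columns and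
      rows of \<open>M\<close> make it doubly stochastic.\<close>
    define m where "m l k = (\<Sum>y<a. \<Sum>p<a. (cmod (M $$ (y * b + l, p * b + k)))\<^sup>2) / real a" for l k
    have m_nn: "0 \<le> m l k" for l k unfolding m_def by (intro divide_nonneg_nonneg sum_nonneg) auto
    have col: "(\<Sum>l<b. m l k) = 1" if k: "k < b" for k
    proof -
      have c1: "(\<Sum>y<a. \<Sum>l<b. (cmod (M $$ (y * b + l, p * b + k)))\<^sup>2) = 1" if p: "p < a" for p
      proof -
        have "complex_of_real (\<Sum>r<a * b. (cmod (M $$ (r, p * b + k)))\<^sup>2) = (\<Sum>r<a * b. cnj (M $$ (r, p * b + k)) * M $$ (r, p * b + k))"
          unfolding of_real_sum complex_norm_square by (simp only: mult.commute)
        also have "\<dots> = of_real 1" using unitary_mat_sums(1)[OF M] pair_index_less[OF p k] by simp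
        finally show ?thesis unfolding sum_pair_index of_real_eq_iff .
      qed
      have "(\<Sum>l<b. m l k) = (\<Sum>l<b. \<Sum>y<a. \<Sum>p<a. (cmod (M $$ (y * b + l, p * b + k)))\<^sup>2) / real a"
        unfolding m_def sum_divide_distrib ..
      also have "(\<Sum>l<b. \<Sum>y<a. \<Sum>p<a. (cmod (M $$ (y * b + l, p * b + k)))\<^sup>2)
          = (\<Sum>y<a. \<Sum>l<b. \<Sum>p<a. (cmod (M $$ (y * b + l, p * b + k)))\<^sup>2)" by (rule sum.swap)
      also have "\<dots> = (\<Sum>y<a. \<Sum>p<a. \<Sum>l<b. (cmod (M $$ (y * b + l, p * b + k)))\<^sup>2)"
        by (rule sum.cong[OF refl], rule sum.swap)
      also have "\<dots> = (\<Sum>p<a. \<Sum>y<a. \<Sum>l<b. (cmod (M $$ (y * b + l, p * b + k)))\<^sup>2)" by (rule sum.swap)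
      also have "\<dots> = real a" by (simp add: c1)
      finally show ?thesis using a by simp
    qed
    have row: "(\<Sum>k<b. m l k) = 1" if l: "l < b" for l
    proof -
      have c1: "(\<Sum>p<a. \<Sum>k<b. (cmod (M $$ (y * b + l, p * b + k)))\<^sup>2) = 1" if y: "y < a" for y
      proof -
        have "complex_of_real (\<Sum>r<a * b. (cmod (M $$ (y * b + l, r)))\<^sup>2) = (\<Sum>r<a * b. M $$ (y * b + l, r) * cnj (M $$ (y * b + l, r)))"
          unfolding of_real_sum complex_norm_square ..
        also have "\<dots> = of_real 1" using unitary_mat_sums(2)[OF M] pair_index_less[OF y l] by simp
        finally show ?thesis unfolding sum_pair_index of_real_eq_iff .
      qed
      have "(\<Sum>k<b. m l k) = (\<Sum>k<b. \<Sum>y<a. \<Sum>p<a. (cmod (M $$ (y * b + l, p * b + k)))\<^sup>2) / real a"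
        unfolding m_def sum_divide_distrib ..
      also have "(\<Sum>k<b. \<Sum>y<a. \<Sum>p<a. (cmod (M $$ (y * b + l, p * b + k)))\<^sup>2)
          = (\<Sum>y<a. \<Sum>k<b. \<Sum>p<a. (cmod (M $$ (y * b + l, p * b + k)))\<^sup>2)" by (rule sum.swap)
      also have "\<dots> = (\<Sum>y<a. \<Sum>p<a. \<Sum>k<b. (cmod (M $$ (y * b + l, p * b + k)))\<^sup>2)"
        by (rule sum.cong[OF refl], rule sum.swap)
      also have "\<dots> = real a" by (simp add: c1)
      finally show ?thesis using a by simp
    qed
    \<comment> \<open>The diagonal entry \<open>(l, l)\<close> of the catalyst condition at the
      maximally mixed input, where the diagonality of the input leaves only squared moduli.\<close>
    have fixed: "(\<Sum>k<b. m l k * s k) = s l" if l: "l < b" for l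
    proof -
      let ?\<mu> = "max_mixed a"
      note st = max_mixed_state[OF a]
      have "complex_of_real (s l) = (\<Sum>y<a. (M * kron ?\<mu> D * mat_adjoint M) $$ (y * b + l, y * b + l))"
        using arg_cong[OF pt(2)[OF st], of "\<lambda>X. X $$ (l, l)"] l by (simp add: ptrace_fst_def D(2))
      also have "\<dots> = (\<Sum>y<a. \<Sum>p<a. \<Sum>k<b. of_real ((cmod (M $$ (y * b + l, p * b + k)))\<^sup>2 / real a * s k))"
      proof (rule sum.cong[OF refl])
        fix y assume "y \<in> {..<a}"
        then have y: "y * b + l < a * b" using l by (auto intro: pair_index_less)
        have "(M * kron ?\<mu> D * mat_adjoint M) $$ (y * b + l, y * b + l) = (\<Sum>p<a. \<Sum>q<a. \<Sum>k<b.
            ?\<mu> $$ (p, q) * (of_real (s k) * (M $$ (y * b + l, p * b + k) * cnj (M $$ (y * b + l, q * b + k)))))"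
          by (rule conj_kron_diag_index[OF Mc rc[OF st] D y y])
        also have "\<dots> = (\<Sum>p<a. \<Sum>q<a. if q = p then
            (\<Sum>k<b. of_real ((cmod (M $$ (y * b + l, p * b + k)))\<^sup>2 / real a * s k)) else 0)"
        proof (intro sum.cong refl)
          fix p q assume "p \<in> {..<a}" "q \<in> {..<a}"
          then have \<mu>: "?\<mu> $$ (p, p) = 1 / of_nat a" "q \<noteq> p \<Longrightarrow> ?\<mu> $$ (p, q) = 0"
            by (simp_all add: max_mixed_def)
          have tm: "1 / of_nat a * (of_real (s k) * (M $$ (y * b + l, p * b + k) * cnj (M $$ (y * b + l, p * b + k))))
              = of_real ((cmod (M $$ (y * b + l, p * b + k)))\<^sup>2 / real a * s k)" for k
            unfolding of_real_mult of_real_divide complex_norm_square by simp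
          show "(\<Sum>k<b. ?\<mu> $$ (p, q) * (of_real (s k) * (M $$ (y * b + l, p * b + k) * cnj (M $$ (y * b + l, q * b + k)))))
              = (if q = p then (\<Sum>k<b. of_real ((cmod (M $$ (y * b + l, p * b + k)))\<^sup>2 / real a * s k)) else 0)"
            by (cases "q = p") (simp_all only: \<mu> tm if_True if_False simp_thms not_False_eq_True mult_zero_left sum.neutral_const)
        qed
        also have "\<dots> = (\<Sum>p<a. \<Sum>k<b. of_real ((cmod (M $$ (y * b + l, p * b + k)))\<^sup>2 / real a * s k))"
          by (rule sum.cong[OF refl], subst sum.delta[OF finite_lessThan], erule if_P)
        finally show "(M * kron ?\<mu> D * mat_adjoint M) $$ (y * b + l, y * b + l)
            = (\<Sum>p<a. \<Sum>k<b. of_real ((cmod (M $$ (y * b + l, p * b + k)))\<^sup>2 / real a * s k))" .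
      qed
      also have "\<dots> = of_real (\<Sum>y<a. \<Sum>p<a. \<Sum>k<b. (cmod (M $$ (y * b + l, p * b + k)))\<^sup>2 / real a * s k)"
        by (simp only: of_real_sum)
      also have "(\<Sum>y<a. \<Sum>p<a. \<Sum>k<b. (cmod (M $$ (y * b + l, p * b + k)))\<^sup>2 / real a * s k)
          = (\<Sum>y<a. \<Sum>k<b. \<Sum>p<a. (cmod (M $$ (y * b + l, p * b + k)))\<^sup>2 / real a * s k)"
        by (rule sum.cong[OF refl], rule sum.swap)
      also have "\<dots> = (\<Sum>k<b. \<Sum>y<a. \<Sum>p<a. (cmod (M $$ (y * b + l, p * b + k)))\<^sup>2 / real a * s k)"
        by (rule sum.swap)
      also have "\<dots> = (\<Sum>k<b. m l k * s k)"
        unfolding m_def sum_divide_distrib sum_distrib_right ..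
      finally show ?thesis by (simp only: of_real_eq_iff)
    qed
    fix y l p k assume ix: "y < a" "l < b" "p < a" "k < b" "s l \<noteq> s k"
    have "m l k = 0"
      by (rule doubly_stochastic_fixed_vector[OF m_nn row col fixed ix(2,4,5)])
    \<comment> \<open>A vanishing average of squared moduli forces every entry of the block to
      vanish.\<close>
    then have "(\<Sum>y<a. \<Sum>p<a. (cmod (M $$ (y * b + l, p * b + k)))\<^sup>2) = 0" using a by (simp add: m_def)
    then have "(\<Sum>p<a. (cmod (M $$ (y * b + l, p * b + k)))\<^sup>2) = 0"
      using ix(1) by (subst (asm) sum_nonneg_eq_0_iff) (auto intro!: sum_nonneg)
    then have "(cmod (M $$ (y * b + l, p * b + k)))\<^sup>2 = 0"
      using ix(3) by (subst (asm) sum_nonneg_eq_0_iff) auto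
    then show "M $$ (y * b + l, p * b + k) = 0" by simp
  qed
qed

subsection \<open>Product inputs\<close>

lemma sum_div_mod_product:
  fixes f g :: "nat \<Rightarrow> 'a::comm_semiring_0"
  shows "(\<Sum>p<m * n. f (p div n) * g (p mod n)) = (\<Sum>i<m. f i) * (\<Sum>k<n. g k)"
  unfolding sum_pair_index sum_product by (intro sum.cong refl) simp

text \<open>Packing the index pairs into \<open>p\<close> and \<open>q\<close> displays each output
  entry as a linear functional of the input with explicit coefficients, to be compared with the
  Kraus form of the implementation.\<close>

lemma map_tensor_index:
  assumes car: "\<And>A. A \<in> carrier_mat m m \<Longrightarrow> \<Phi> A \<in> carrier_mat m m"
      "\<And>A. A \<in> carrier_mat n n \<Longrightarrow> \<Psi> A \<in> carrier_mat n n"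
    and y: "y < m * n" "y' < m * n"
  shows "map_tensor m n \<Phi> \<Psi> X $$ (y, y') = (\<Sum>p<m * n. \<Sum>q<m * n. X $$ (p, q) *
    (\<Phi> (mat_unit m (p div n) (q div n)) $$ (y div n, y' div n)
      * \<Psi> (mat_unit n (p mod n) (q mod n)) $$ (y mod n, y' mod n)))"
proof -
  have k: "kron (\<Phi> (mat_unit m i j)) (\<Psi> (mat_unit n k l)) $$ (y, y')
      = \<Phi> (mat_unit m i j) $$ (y div n, y' div n) * \<Psi> (mat_unit n k l) $$ (y mod n, y' mod n)" for i j k l
  proof -
    have "\<Phi> (mat_unit m i j) \<in> carrier_mat m m" "\<Psi> (mat_unit n k l) \<in> carrier_mat n n"
      by (intro car; simp add: mat_unit_def)+
    then show ?thesis using y by (simp add: kron_def)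
  qed
  have "(\<Sum>p<m * n. \<Sum>q<m * n. X $$ (p, q) *
      (\<Phi> (mat_unit m (p div n) (q div n)) $$ (y div n, y' div n)
        * \<Psi> (mat_unit n (p mod n) (q mod n)) $$ (y mod n, y' mod n)))
    = (\<Sum>i<m. \<Sum>k<n. \<Sum>j<m. \<Sum>l<n. X $$ (i * n + k, j * n + l) *
      (\<Phi> (mat_unit m i j) $$ (y div n, y' div n) * \<Psi> (mat_unit n k l) $$ (y mod n, y' mod n)))"
    unfolding sum_pair_index by (intro sum.cong refl) simp
  also have "\<dots> = (\<Sum>i<m. \<Sum>j<m. \<Sum>k<n. \<Sum>l<n. X $$ (i * n + k, j * n + l) *
      (\<Phi> (mat_unit m i j) $$ (y div n, y' div n) * \<Psi> (mat_unit n k l) $$ (y mod n, y' mod n)))"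
    by (rule sum.cong[OF refl], rule sum.swap)
  also have "\<dots> = map_tensor m n \<Phi> \<Psi> X $$ (y, y')"
    unfolding map_tensor_def using y by (simp only: k index_mat case_prod_conv)
  finally show ?thesis by simp
qed

text \<open>At the reference indices \<open>(x, x')\<close> only the matrix unit with these indices
  is nonzero, so the map acts on a single block of the input.\<close>

lemma ampliation_index:
  assumes car: "\<And>A. A \<in> carrier_mat d d \<Longrightarrow> \<Psi> A \<in> carrier_mat d d"
    and x: "x < r" "x' < r" and y: "y < d" "y' < d"
  shows "map_tensor r d (\<lambda>X. X) \<Psi> \<rho> $$ (x * d + y, x' * d + y')
    = (\<Sum>k<d. \<Sum>l<d. \<rho> $$ (x * d + k, x' * d + l) * \<Psi> (mat_unit d k l) $$ (y, y'))"
proof -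
  let ?h = "\<lambda>i j k l. \<rho> $$ (i * d + k, j * d + l) * \<Psi> (mat_unit d k l) $$ (y, y')"
  have "map_tensor r d (\<lambda>X. X) \<Psi> \<rho> $$ (x * d + y, x' * d + y') = (\<Sum>p<r * d. \<Sum>q<r * d. \<rho> $$ (p, q) *
    (mat_unit r (p div d) (q div d) $$ (x, x') * \<Psi> (mat_unit d (p mod d) (q mod d)) $$ (y, y')))"
    using map_tensor_index[where \<Phi> = "\<lambda>X. X" and X = \<rho>, OF _ car
        pair_index_less[OF x(1) y(1)] pair_index_less[OF x(2) y(2)]] y
    by simp
  also have "\<dots> = (\<Sum>i<r. \<Sum>k<d. \<Sum>j<r. \<Sum>l<d. if j = x' then (if i = x then ?h x x' k l else 0) else 0)"
    unfolding sum_pair_index by (intro sum.cong refl) (use x in \<open>auto simp: mat_unit_def\<close>)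
  also have "\<dots> = (\<Sum>i<r. \<Sum>k<d. \<Sum>j<r. if j = x' then (\<Sum>l<d. if i = x then ?h x x' k l else 0) else 0)"
    by (intro sum.cong refl) auto
  also have "\<dots> = (\<Sum>i<r. \<Sum>k<d. \<Sum>l<d. if i = x then ?h x x' k l else 0)"
    using x by simp
  also have "\<dots> = (\<Sum>i<r. if i = x then (\<Sum>k<d. \<Sum>l<d. ?h x x' k l) else 0)"
    by (intro sum.cong refl) auto
  also have "\<dots> = (\<Sum>k<d. \<Sum>l<d. ?h x x' k l)" using x by simp
  finally show ?thesis .
qed

text \<open>Complete positivity is positivity of this very map. The trace is preserved because the
  images of matrix units keep the traces of these units, 1 on the diagonal and 0 off it.\<close>

lemma ampliation_state:
  assumes qm: "quantum_map d \<Psi>" and st: "quantum_state (r * d) \<rho>"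
  shows "quantum_state (r * d) (map_tensor r d (\<lambda>X. X) \<Psi> \<rho>)"
proof -
  have car: "\<And>A. A \<in> carrier_mat d d \<Longrightarrow> \<Psi> A \<in> carrier_mat d d"
    using qm by (simp add: quantum_map_def linear_on_mats_def)
  have R: "\<rho> \<in> carrier_mat (r * d) (r * d)" and tr\<rho>: "mat_trace \<rho> = 1"
    using st by (simp_all add: quantum_state_def psd_mat_def hermitian_mat_def)
  have tr: "(\<Sum>y<d. \<Psi> (mat_unit d k l) $$ (y, y)) = (if l = k then 1 else 0)" if "k < d" "l < d" for k l
  proof -
    have E: "mat_unit d k l \<in> carrier_mat d d" by (simp add: mat_unit_def)
    have "(\<Sum>y<d. \<Psi> (mat_unit d k l) $$ (y, y)) = mat_trace (\<Psi> (mat_unit d k l))"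
      using car[OF E] by (simp add: mat_trace_def)
    also have "\<dots> = mat_trace (mat_unit d k l)"
      using qm E by (simp add: quantum_map_def trace_preserving_def)
    also have "\<dots> = (\<Sum>y<d. if y = k then (if l = k then 1 else 0) else 0)"
      unfolding mat_trace_def by (intro sum.cong) (auto simp: mat_unit_def)
    finally show ?thesis using that by simp
  qed
  have dim: "dim_row (map_tensor r d (\<lambda>X. X) \<Psi> \<rho>) = r * d" by (simp add: map_tensor_def)
  have "mat_trace (map_tensor r d (\<lambda>X. X) \<Psi> \<rho>)
      = (\<Sum>x<r. \<Sum>y<d. map_tensor r d (\<lambda>X. X) \<Psi> \<rho> $$ (x * d + y, x * d + y))"
    unfolding mat_trace_def dim by (rule sum_pair_index)
  also have "\<dots> = (\<Sum>x<r. \<Sum>y<d. \<Sum>k<d. \<Sum>l<d. \<rho> $$ (x * d + k, x * d + l) * \<Psi> (mat_unit d k l) $$ (y, y))"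
    by (intro sum.cong refl ampliation_index car) auto
  also have "\<dots> = (\<Sum>x<r. \<Sum>k<d. \<Sum>l<d. \<Sum>y<d. \<rho> $$ (x * d + k, x * d + l) * \<Psi> (mat_unit d k l) $$ (y, y))"
    by (rule sum.cong[OF refl], subst sum.swap, rule sum.cong[OF refl], rule sum.swap)
  also have "\<dots> = (\<Sum>x<r. \<Sum>k<d. \<Sum>l<d. if l = k then \<rho> $$ (x * d + k, x * d + k) else 0)"
    by (intro sum.cong refl, subst sum_distrib_left[symmetric]) (auto simp: tr)
  also have "\<dots> = (\<Sum>x<r. \<Sum>k<d. \<rho> $$ (x * d + k, x * d + k))" by simp
  also have "\<dots> = mat_trace \<rho>" using R by (simp add: mat_trace_def sum_pair_index)
  finally have "mat_trace (map_tensor r d (\<lambda>X. X) \<Psi> \<rho>) = 1" using tr\<rho> by simp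
  moreover have "psd_mat (r * d) (map_tensor r d (\<lambda>X. X) \<Psi> \<rho>)"
    using qm st by (simp add: quantum_map_def completely_positive_def quantum_state_def)
  ultimately show ?thesis by (simp add: quantum_state_def)
qed

text \<open>The product of two bases, on the reordered system consisting of both references
  (the pair) and of the two inputs (the single index \<open>p\<close>).\<close>

definition product_basis ::
    "nat \<Rightarrow> nat \<Rightarrow> (nat \<Rightarrow> nat \<Rightarrow> complex) \<Rightarrow> (nat \<Rightarrow> nat \<Rightarrow> complex)
      \<Rightarrow> nat \<times> nat \<Rightarrow> (nat \<times> nat) \<times> nat \<Rightarrow> complex" where
  "product_basis d1 d2 e1 e2 = (\<lambda>(i, j) ((x1, x2), p). e1 i (x1 * d1 + p div d2) * e2 j (x2 * d2 + p mod d2))"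

text \<open>The quotient of \<open>p\<close> by \<open>d2\<close> belongs to the first input and the
  remainder to the second, so the sum over the reordered system factors into one sum for each input
  with its reference.\<close>

lemma sum_product_index:
  fixes F G :: "nat \<Rightarrow> 'a::comm_semiring_0"
  shows "(\<Sum>((x1, x2), p)\<in>({..<r1} \<times> {..<r2}) \<times> {..<d1 * d2}. F (x1 * d1 + p div d2) * G (x2 * d2 + p mod d2))
    = (\<Sum>x<r1 * d1. F x) * (\<Sum>x<r2 * d2. G x)"
proof -
  have "(\<Sum>((x1, x2), p)\<in>({..<r1} \<times> {..<r2}) \<times> {..<d1 * d2}. F (x1 * d1 + p div d2) * G (x2 * d2 + p mod d2))
      = (\<Sum>x1<r1. \<Sum>x2<r2. \<Sum>p<d1 * d2. F (x1 * d1 + p div d2) * G (x2 * d2 + p mod d2))"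
    by (simp add: sum.cartesian_product')
  also have "\<dots> = (\<Sum>x1<r1. \<Sum>x2<r2. (\<Sum>p<d1. F (x1 * d1 + p)) * (\<Sum>p<d2. G (x2 * d2 + p)))"
    by (intro sum.cong refl) (rule sum_div_mod_product)
  also have "\<dots> = (\<Sum>x<r1 * d1. F x) * (\<Sum>x<r2 * d2. G x)"
    unfolding sum_pair_index sum_product[symmetric] ..
  finally show ?thesis .
qed

lemma product_basis_orth:
  assumes es: "eigensystem (r1 * d1) A1 e1 l1" "eigensystem (r2 * d2) A2 e2 l2"
    and mn: "m \<in> {..<r1 * d1} \<times> {..<r2 * d2}" "n \<in> {..<r1 * d1} \<times> {..<r2 * d2}"
  shows "(\<Sum>z\<in>({..<r1} \<times> {..<r2}) \<times> {..<d1 * d2}. product_basis d1 d2 e1 e2 m z * cnj (product_basis d1 d2 e1 e2 n z))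
    = (if m = n then 1 else 0)"
proof -
  obtain m1 m2 n1 n2 where mn': "m = (m1, m2)" "n = (n1, n2)" by (cases m, cases n)
  have "(\<Sum>z\<in>({..<r1} \<times> {..<r2}) \<times> {..<d1 * d2}. product_basis d1 d2 e1 e2 m z * cnj (product_basis d1 d2 e1 e2 n z))
      = (\<Sum>x<r1 * d1. e1 m1 x * cnj (e1 n1 x)) * (\<Sum>x<r2 * d2. e2 m2 x * cnj (e2 n2 x))"
    unfolding sum_product_index[symmetric] mn' product_basis_def
    by (intro sum.cong refl) (auto simp: mult_ac)
  then show ?thesis using mn mn' by (auto simp: eigensystem_orth[OF es(1)] eigensystem_orth[OF es(2)])
qed

text \<open>Used with coefficients 1 for completeness, and with eigenvalues to obtain the entries of
  a product operator on the reordered system.\<close>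

lemma product_basis_expand:
  fixes c1 c2 :: "nat \<Rightarrow> complex"
  shows "(\<Sum>m\<in>{..<n1} \<times> {..<n2}. (case m of (i, j) \<Rightarrow> c1 i * c2 j) *
      (product_basis d1 d2 e1 e2 m ((x1, x2), p) * cnj (product_basis d1 d2 e1 e2 m ((x1', x2'), p'))))
    = (\<Sum>i<n1. c1 i * (e1 i (x1 * d1 + p div d2) * cnj (e1 i (x1' * d1 + p' div d2))))
      * (\<Sum>j<n2. c2 j * (e2 j (x2 * d2 + p mod d2) * cnj (e2 j (x2' * d2 + p' mod d2))))"
  unfolding sum_product sum.cartesian_product
proof (rule sum.cong[OF refl])
  fix m :: "nat \<times> nat"
  obtain i j where "m = (i, j)" by (cases m)
  then show "(case m of (i, j) \<Rightarrow> c1 i * c2 j) *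
      (product_basis d1 d2 e1 e2 m ((x1, x2), p) * cnj (product_basis d1 d2 e1 e2 m ((x1', x2'), p')))
    = (case m of (i, j) \<Rightarrow> c1 i * (e1 i (x1 * d1 + p div d2) * cnj (e1 i (x1' * d1 + p' div d2)))
        * (c2 j * (e2 j (x2 * d2 + p mod d2) * cnj (e2 j (x2' * d2 + p' mod d2)))))"
    by (simp add: product_basis_def mult_ac)
qed

lemma product_index_less:
  fixes d1 d2 p r1 r2 x1 x2 :: nat
  assumes "x1 < r1" "x2 < r2" "p < d1 * d2"
  shows "p div d2 < d1" "p mod d2 < d2" "x1 * d1 + p div d2 < r1 * d1" "x2 * d2 + p mod d2 < r2 * d2"
proof -
  show a: "p div d2 < d1" using assms(3) by (simp add: less_mult_imp_div_less)
  show b: "p mod d2 < d2" using assms(3) by (cases d2) auto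
  show "x1 * d1 + p div d2 < r1 * d1" by (rule pair_index_less[OF assms(1) a])
  show "x2 * d2 + p mod d2 < r2 * d2" by (rule pair_index_less[OF assms(2) b])
qed

lemma product_basis_complete:
  assumes es: "eigensystem (r1 * d1) A1 e1 l1" "eigensystem (r2 * d2) A2 e2 l2"
    and z: "z \<in> ({..<r1} \<times> {..<r2}) \<times> {..<d1 * d2}" "z' \<in> ({..<r1} \<times> {..<r2}) \<times> {..<d1 * d2}"
  shows "(\<Sum>m\<in>{..<r1 * d1} \<times> {..<r2 * d2}. product_basis d1 d2 e1 e2 m z * cnj (product_basis d1 d2 e1 e2 m z'))
    = (if z = z' then 1 else 0)"
proof -
  obtain x1 x2 p x1' x2' p' where zz: "z = ((x1, x2), p)" "z' = ((x1', x2'), p')"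
    by (metis surj_pair)
  have b: "x1 < r1" "x2 < r2" "p < d1 * d2" "x1' < r1" "x2' < r2" "p' < d1 * d2"
    using z zz by auto
  note l = product_index_less[OF b(1-3)] and l' = product_index_less[OF b(4-6)]
  have "(\<Sum>m\<in>{..<r1 * d1} \<times> {..<r2 * d2}. product_basis d1 d2 e1 e2 m z * cnj (product_basis d1 d2 e1 e2 m z'))
      = (\<Sum>i<r1 * d1. e1 i (x1 * d1 + p div d2) * cnj (e1 i (x1' * d1 + p' div d2)))
        * (\<Sum>j<r2 * d2. e2 j (x2 * d2 + p mod d2) * cnj (e2 j (x2' * d2 + p' mod d2)))"
    using product_basis_expand[of "\<lambda>_. 1" "\<lambda>_. 1"] by (simp add: zz case_prod_unfold)
  also have "\<dots> = (if x1 * d1 + p div d2 = x1' * d1 + p' div d2 \<and> x2 * d2 + p mod d2 = x2' * d2 + p' mod d2 then 1 else 0)"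
    by (simp add: eigensystem_complete[OF es(1) l(3) l'(3)] eigensystem_complete[OF es(2) l(4) l'(4)])
  also have "x1 * d1 + p div d2 = x1' * d1 + p' div d2 \<and> x2 * d2 + p mod d2 = x2' * d2 + p' mod d2 \<longleftrightarrow> z = z'"
    unfolding pair_index_eq_iff[OF l(1) l'(1)] pair_index_eq_iff[OF l(2) l'(2)] zz
    by (auto, metis div_mult_mod_eq)
  finally show ?thesis .
qed

text \<open>Neither the product input nor its image is formed as a matrix: product bases with
  products of eigenvalues diagonalise both, with the references grouped apart from the inputs. The
  entropies of product spectra add, which separates the contributions of the two maps.\<close>

lemma tensor_entropy_production_le:
  assumes d: "0 < d1" "0 < d2" and \<sigma>: "quantum_state b \<sigma>"
    and \<Psi>: "quantum_map d1 \<Psi>1" "quantum_map d2 \<Psi>2"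
    and impl: "implemented_catalytically (d1 * d2) (map_tensor d1 d2 \<Psi>1 \<Psi>2) b \<sigma>"
    and \<rho>: "quantum_state (r1 * d1) \<rho>1" "quantum_state (r2 * d2) \<rho>2"
  shows "(vn_entropy (map_tensor r1 d1 (\<lambda>X. X) \<Psi>1 \<rho>1) - vn_entropy \<rho>1)
    + (vn_entropy (map_tensor r2 d2 (\<lambda>X. X) \<Psi>2 \<rho>2) - vn_entropy \<rho>2) \<le> catalytic_entropy \<sigma>"
proof -
  let ?a = "d1 * d2" and ?\<omega>1 = "map_tensor r1 d1 (\<lambda>X. X) \<Psi>1 \<rho>1" and ?\<omega>2 = "map_tensor r2 d2 (\<lambda>X. X) \<Psi>2 \<rho>2"
  have car1: "\<And>A. A \<in> carrier_mat d1 d1 \<Longrightarrow> \<Psi>1 A \<in> carrier_mat d1 d1"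
    and car2: "\<And>A. A \<in> carrier_mat d2 d2 \<Longrightarrow> \<Psi>2 A \<in> carrier_mat d2 d2"
    using \<Psi> by (simp_all add: quantum_map_def linear_on_mats_def)
  obtain f s where f: "eigensystem b \<sigma> f s" and s: "\<And>k. k < b \<Longrightarrow> 0 \<le> s k" "(\<Sum>k<b. s k) = 1"
    using quantum_state_eigensystem[OF \<sigma>] by blast
  obtain g1 q1 where g1: "eigensystem (r1 * d1) \<rho>1 g1 q1" and q1: "\<And>i. i < r1 * d1 \<Longrightarrow> 0 \<le> q1 i" "(\<Sum>i<r1 * d1. q1 i) = 1"
    using quantum_state_eigensystem[OF \<rho>(1)] by blast
  obtain g2 q2 where g2: "eigensystem (r2 * d2) \<rho>2 g2 q2" and q2: "\<And>i. i < r2 * d2 \<Longrightarrow> 0 \<le> q2 i" "(\<Sum>i<r2 * d2. q2 i) = 1"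
    using quantum_state_eigensystem[OF \<rho>(2)] by blast
  obtain e1 l1 where e1: "eigensystem (r1 * d1) ?\<omega>1 e1 l1" and l1: "\<And>i. i < r1 * d1 \<Longrightarrow> 0 \<le> l1 i" "(\<Sum>i<r1 * d1. l1 i) = 1"
    using quantum_state_eigensystem[OF ampliation_state[OF \<Psi>(1) \<rho>(1)]] by blast
  obtain e2 l2 where e2: "eigensystem (r2 * d2) ?\<omega>2 e2 l2" and l2: "\<And>i. i < r2 * d2 \<Longrightarrow> 0 \<le> l2 i" "(\<Sum>i<r2 * d2. l2 i) = 1"
    using quantum_state_eigensystem[OF ampliation_state[OF \<Psi>(2) \<rho>(2)]] by blast
  have a: "0 < ?a" using d by simp
  obtain M where M: "unitary_mat (?a * b) M"
    and \<Phi>: "\<And>\<rho> y y'. quantum_state ?a \<rho> \<Longrightarrow> y < ?a \<Longrightarrow> y' < ?a \<Longrightarrow> map_tensor d1 d2 \<Psi>1 \<Psi>2 \<rho> $$ (y, y') =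
      (\<Sum>p<?a. \<Sum>q<?a. \<rho> $$ (p, q) *
        (\<Sum>k<b. \<Sum>l<b. of_real (s k) * (M $$ (y * b + l, p * b + k) * cnj (M $$ (y' * b + l, q * b + k)))))"
    and block: "\<And>y l p k. y < ?a \<Longrightarrow> l < b \<Longrightarrow> p < ?a \<Longrightarrow> k < b \<Longrightarrow> s l \<noteq> s k \<Longrightarrow> M $$ (y * b + l, p * b + k) = 0"
    by (rule catalytic_normal_form[OF a impl f]) blast
  \<comment> \<open>Both sides are coefficients of linear functionals that agree on all states,
    hence they are equal. In this form the Kraus identity can be applied in the presence of
    references.\<close>
  have kraus: "\<Psi>1 (mat_unit d1 (p div d2) (q div d2)) $$ (y div d2, y' div d2)
        * \<Psi>2 (mat_unit d2 (p mod d2) (q mod d2)) $$ (y mod d2, y' mod d2)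
      = (\<Sum>k<b. \<Sum>l<b. of_real (s k) * (M $$ (y * b + l, p * b + k) * cnj (M $$ (y' * b + l, q * b + k))))"
      (is "?L p q = ?R p q")
    if y: "y < ?a" "y' < ?a" and pq: "p < ?a" "q < ?a" for y y' p q
  proof -
    have "?L p q - ?R p q = 0"
    proof (rule functional_zero_on_states[OF _ pq])
      fix \<rho> assume st: "quantum_state ?a \<rho>"
      have "(\<Sum>p<?a. \<Sum>q<?a. \<rho> $$ (p, q) * ?L p q) = map_tensor d1 d2 \<Psi>1 \<Psi>2 \<rho> $$ (y, y')"
        by (rule map_tensor_index[OF car1 car2 y, symmetric])
      also have "\<dots> = (\<Sum>p<?a. \<Sum>q<?a. \<rho> $$ (p, q) * ?R p q)"
        by (rule \<Phi>[OF st y])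
      finally show "(\<Sum>p<?a. \<Sum>q<?a. \<rho> $$ (p, q) * (?L p q - ?R p q)) = 0"
        by (simp only: right_diff_distrib sum_subtractf diff_self)
    qed
    then show ?thesis by simp
  qed
  let ?I = "{..<r1 * d1} \<times> {..<r2 * d2}" and ?R = "{..<r1} \<times> {..<r2}"
  let ?l = "\<lambda>(i, j). l1 i * l2 j" and ?q = "\<lambda>(i, j). q1 i * q2 j"
  have "- (\<Sum>m\<in>?I. ?l m * log 2 (?l m)) + (\<Sum>t\<in>?I. ?q t * log 2 (?q t))
    \<le> - (\<Sum>k<b. s k * log 2 (s k / real (card {l\<in>{..<b}. s l = s k})))"
  proof (rule catalytic_entropy_bound[where R = ?R and a = ?a and e = "product_basis d1 d2 e1 e2"
        and g = "product_basis d1 d2 g1 g2" and W = "\<lambda>y l p k. M $$ (y * b + l, p * b + k)"])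
    show "0 \<le> ?q t" if "t \<in> ?I" for t using that q1 q2 by auto
    have "(\<Sum>t\<in>?I. ?q t) = (\<Sum>i<r1 * d1. q1 i) * (\<Sum>j<r2 * d2. q2 j)"
      unfolding sum_product sum.cartesian_product by (rule sum.cong) auto
    then show "(\<Sum>t\<in>?I. ?q t) = 1" using q1 q2 by simp
    show "(\<Sum>z\<in>?R \<times> {..<?a}. (cmod (product_basis d1 d2 g1 g2 t z))\<^sup>2) = 1" if "t \<in> ?I" for t
    proof -
      have "complex_of_real (\<Sum>z\<in>?R \<times> {..<?a}. (cmod (product_basis d1 d2 g1 g2 t z))\<^sup>2) = of_real 1"
        unfolding of_real_sum complex_norm_square product_basis_orth[OF g1 g2 that that] by simp
      then show ?thesis unfolding of_real_eq_iff .
    qed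
    show "(\<Sum>y<?a. \<Sum>l<b. (cmod (\<Sum>p<?a. M $$ (y * b + l, p * b + k) * v p))\<^sup>2) = (\<Sum>p<?a. (cmod (v p))\<^sup>2)"
      if "k < b" for k v by (rule isometry_of_unitary[OF M that])
  next
    fix x x' :: "nat \<times> nat" and y y' assume xy: "x \<in> ?R" "y < ?a" "x' \<in> ?R" "y' < ?a"
    then obtain x1 x2 x1' x2' where x: "x = (x1, x2)" "x' = (x1', x2')" "x1 < r1" "x2 < r2" "x1' < r1" "x2' < r2"
      by auto
    note yl = product_index_less[OF x(3,4) xy(2)] and yl' = product_index_less[OF x(5,6) xy(4)]
    let ?A = "\<lambda>k k'. \<rho>1 $$ (x1 * d1 + k, x1' * d1 + k') * \<Psi>1 (mat_unit d1 k k') $$ (y div d2, y' div d2)"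
    let ?B = "\<lambda>k k'. \<rho>2 $$ (x2 * d2 + k, x2' * d2 + k') * \<Psi>2 (mat_unit d2 k k') $$ (y mod d2, y' mod d2)"
    have "(\<Sum>m\<in>?I. of_real (?l m) * (product_basis d1 d2 e1 e2 m (x, y) * cnj (product_basis d1 d2 e1 e2 m (x', y'))))
        = ?\<omega>1 $$ (x1 * d1 + y div d2, x1' * d1 + y' div d2) * ?\<omega>2 $$ (x2 * d2 + y mod d2, x2' * d2 + y' mod d2)"
      using product_basis_expand[where ?c1.0 = "\<lambda>i. of_real (l1 i)" and ?c2.0 = "\<lambda>j. of_real (l2 j)"]
      unfolding eigensystem_index[OF e1 yl(3) yl'(3)] eigensystem_index[OF e2 yl(4) yl'(4)] x(1,2)
      by (simp add: case_prod_unfold)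
    also have "\<dots> = (\<Sum>k<d1. \<Sum>k'<d1. ?A k k') * (\<Sum>k<d2. \<Sum>k'<d2. ?B k k')"
      by (intro arg_cong2[where f = "(*)"] ampliation_index car1 car2 x(3-6) yl(1,2) yl'(1,2))
    \<comment> \<open>The row indices of the two factors are packed into \<open>p\<close>, the
      column indices into \<open>p'\<close>.\<close>
    also have "\<dots> = (\<Sum>p<?a. \<Sum>p'<?a. ?A (p div d2) (p' div d2) * ?B (p mod d2) (p' mod d2))"
      unfolding sum_div_mod_product[of "?A _" d2 "?B _" d1] by (rule sum_div_mod_product[symmetric])
    also have "\<dots> = (\<Sum>p<?a. \<Sum>p'<?a. (\<Sum>t\<in>?I. of_real (?q t) * (product_basis d1 d2 g1 g2 t (x, p) * cnj (product_basis d1 d2 g1 g2 t (x', p'))))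
          * (\<Sum>k<b. \<Sum>l<b. of_real (s k) * (M $$ (y * b + l, p * b + k) * cnj (M $$ (y' * b + l, p' * b + k)))))"
    proof (intro sum.cong refl)
      fix p p' assume "p \<in> {..<?a}" "p' \<in> {..<?a}"
      then have pp: "p < ?a" "p' < ?a" by auto
      note pl = product_index_less[OF x(3,4) pp(1)] and pl' = product_index_less[OF x(5,6) pp(2)]
      have "(\<Sum>t\<in>?I. of_real (?q t) * (product_basis d1 d2 g1 g2 t (x, p) * cnj (product_basis d1 d2 g1 g2 t (x', p'))))
          = \<rho>1 $$ (x1 * d1 + p div d2, x1' * d1 + p' div d2) * \<rho>2 $$ (x2 * d2 + p mod d2, x2' * d2 + p' mod d2)"
        using product_basis_expand[where ?c1.0 = "\<lambda>i. of_real (q1 i)" and ?c2.0 = "\<lambda>j. of_real (q2 j)"]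
        unfolding eigensystem_index[OF g1 pl(3) pl'(3)] eigensystem_index[OF g2 pl(4) pl'(4)] x(1,2)
        by (simp add: case_prod_unfold)
      then show "?A (p div d2) (p' div d2) * ?B (p mod d2) (p' mod d2)
        = (\<Sum>t\<in>?I. of_real (?q t) * (product_basis d1 d2 g1 g2 t (x, p) * cnj (product_basis d1 d2 g1 g2 t (x', p'))))
          * (\<Sum>k<b. \<Sum>l<b. of_real (s k) * (M $$ (y * b + l, p * b + k) * cnj (M $$ (y' * b + l, p' * b + k))))"
        unfolding kraus[OF xy(2,4) pp, symmetric] by (simp only: mult_ac)
    qed
    finally show "(\<Sum>m\<in>?I. of_real (?l m) * (product_basis d1 d2 e1 e2 m (x, y) * cnj (product_basis d1 d2 e1 e2 m (x', y'))))
        = (\<Sum>p<?a. \<Sum>p'<?a. (\<Sum>t\<in>?I. of_real (?q t) * (product_basis d1 d2 g1 g2 t (x, p) * cnj (product_basis d1 d2 g1 g2 t (x', p'))))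
          * (\<Sum>k<b. \<Sum>l<b. of_real (s k) * (M $$ (y * b + l, p * b + k) * cnj (M $$ (y' * b + l, p' * b + k)))))" .
  qed (use s block in \<open>simp_all add: product_basis_orth[OF e1 e2] product_basis_complete[OF e1 e2]\<close>)
  moreover have "(\<Sum>m\<in>?I. ?l m * log 2 (?l m)) = (\<Sum>i<r1 * d1. l1 i * log 2 (l1 i)) + (\<Sum>j<r2 * d2. l2 j * log 2 (l2 j))"
    using product_entropy[of "{..<r1 * d1}" l1 "{..<r2 * d2}" l2] l1 l2
    by (simp add: sum.cartesian_product case_prod_unfold)
  moreover have "(\<Sum>m\<in>?I. ?q m * log 2 (?q m)) = (\<Sum>i<r1 * d1. q1 i * log 2 (q1 i)) + (\<Sum>j<r2 * d2. q2 j * log 2 (q2 j))"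
    using product_entropy[of "{..<r1 * d1}" q1 "{..<r2 * d2}" q2] q1 q2
    by (simp add: sum.cartesian_product case_prod_unfold)
  ultimately show ?thesis
    unfolding eigensystem_vn_entropy[OF e1] eigensystem_vn_entropy[OF e2] eigensystem_vn_entropy[OF g1]
      eigensystem_vn_entropy[OF g2] eigensystem_catalytic_entropy[OF f]
    by linarith
qed

theorem corollary14:
  fixes d1 d2 b :: nat
    and \<sigma> :: "complex mat"
    and \<Psi>1 \<Psi>2 :: "complex mat \<Rightarrow> complex mat"
  assumes "0 < d1" and "0 < d2"
    and "quantum_state b \<sigma>"
    and "quantum_map d1 \<Psi>1" and "unital d1 \<Psi>1"
    and "quantum_map d2 \<Psi>2" and "unital d2 \<Psi>2"
    and "global_entropy_production d1 \<Psi>1 + global_entropy_production d2 \<Psi>2 > catalytic_entropy \<sigma>"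
  shows "\<not> implemented_catalytically (d1 * d2) (map_tensor d1 d2 \<Psi>1 \<Psi>2) b \<sigma>"
proof
  assume impl: "implemented_catalytically (d1 * d2) (map_tensor d1 d2 \<Psi>1 \<Psi>2) b \<sigma>"
  define P where "P n \<Phi> = {vn_entropy (map_tensor r n (\<lambda>X. X) \<Phi> \<rho>) - vn_entropy \<rho> | r \<rho>. quantum_state (r * n) \<rho>}"
    for n \<Phi>
  \<comment> \<open>A one-dimensional reference suffices; nonemptiness is what
    \<open>cSup_least\<close> asks of these sets.\<close>
  have ne: "P n \<Phi> \<noteq> {}" if "0 < n" for n \<Phi>
  proof -
    have "quantum_state (1 * n) (max_mixed n)" using max_mixed_state[OF that] by simp
    then show ?thesis unfolding P_def by blast
  qed
  have le: "x1 + x2 \<le> catalytic_entropy \<sigma>" if x: "x1 \<in> P d1 \<Psi>1" "x2 \<in> P d2 \<Psi>2" for x1 x2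
  proof -
    obtain r1 \<rho>1 where 1: "quantum_state (r1 * d1) \<rho>1"
      "x1 = vn_entropy (map_tensor r1 d1 (\<lambda>X. X) \<Psi>1 \<rho>1) - vn_entropy \<rho>1"
      using x(1) by (auto simp: P_def)
    obtain r2 \<rho>2 where 2: "quantum_state (r2 * d2) \<rho>2"
      "x2 = vn_entropy (map_tensor r2 d2 (\<lambda>X. X) \<Psi>2 \<rho>2) - vn_entropy \<rho>2"
      using x(2) by (auto simp: P_def)
    show ?thesis
      unfolding 1(2) 2(2) by (rule tensor_entropy_production_le[OF assms(1-4,6) impl 1(1) 2(1)])
  qed
  \<comment> \<open>The bound holds for each pair of inputs separately, so the suprema are taken one
    after the other, with the second input held fixed at this point.\<close>
  have "Sup (P d1 \<Psi>1) \<le> catalytic_entropy \<sigma> - x2" if "x2 \<in> P d2 \<Psi>2" for x2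
    using le[OF _ that] by (intro cSup_least ne assms(1)) (simp add: le_diff_eq)
  then have "Sup (P d2 \<Psi>2) \<le> catalytic_entropy \<sigma> - Sup (P d1 \<Psi>1)"
    by (intro cSup_least ne assms(2)) (force simp: le_diff_eq)
  then show False using assms(8) unfolding global_entropy_production_def P_def by simp
qed

end
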